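(* Let $\lambda=(\lambda_1\ge\dots\ge\lambda_n\ge0)$ be a partition with $n$ parts and $\tau\in S_n$. There is a column-set preserving, major-index preserving bijection between $\mathrm{InvFree}(\tau\lambda,\tau w_0)$ and $\mathrm{InvFree}(\lambda,w_0)$; consequently \[ \tilde{\mathrm{H}}^{\tau w_0}_{\tau\lambda}(\mathbf{x};q,0)=\tilde{\mathrm{H}}_\lambda(\mathbf{x};q,0). \]
   Context: For $\tau\in S_n$ and a sequence $a=(a_1,\dots,a_n)$, $\tau a=(a_{\tau^{-1}(1)},\dots,a_{\tau^{-1}(n)})$ (permutation of positions); $w_0$ denotes the sequence $(n,n-1,\dots,1)$, so $\tau w_0=(n+1-\tau^{-1}(1),\dots,n+1-\tau^{-1}(n))$, i.e. the rows of shape $\lambda$ together with their basement labels are permuted simultaneously. Big basements: symbols $\infty_1,\dots,\infty_n$ with $\infty_i<\infty_j$ iff $i<j$ and $\infty_i>m$ for every positive integer $m$. For a composition $\alpha$ and a permutation $\sigma$ (as a sequence), the augmented diagram of shape $\alpha$ has rows $1,\dots,n$ from top to bottom, row $r$ consisting of boxes $(r,0),\dots,(r,\alpha_r)$, column $0$ the basement; a filling with big basement $\sigma$ has $F(r,0)=\infty_{\sigma_r}$ and arbitrary positive integers elsewhere. A type $A$ triple is $a=(r,j-1)$, $b=(r,j)$, $c=(k,j)$ with $j\ge1$, $k>r$, $\alpha_r\ge\alpha_k$; a type $B$ triple is $a=(r,j-1)$, $b=(r,j)$, $c=(k,j-1)$ with $j\ge1$, $k<r$, $\alpha_r>\alpha_k$.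 Compare entries by value, ties broken with $a$ largest, then $c$, then $b$. A type $A$ (resp. $B$) triple is an inversion triple if its entries in increasing order form a cyclic rotation of $(a,c,b)$ (resp. $(c,b,a)$). $\mathrm{InvFree}(\alpha,\sigma)$: fillings with no inversion triples. A non-basement box $b$ is a descent if $F(a)<F(b)$ for the box $a$ immediately left of it; $\mathrm{maj}(F)=\sum_{b\text{ descent}}(\mathrm{leg}(b)+1)$, $\mathrm{leg}(b)$ the number of boxes right of $b$ in its row. Column sets: the multisets of non-basement entries in each column. With $\mathbf{x}=(x_1,x_2,\dots)$ and $\mathbf{x}^F=\prod x_{F(u)}$ over non-basement boxes, $\tilde{\mathrm{H}}^\sigma_\alpha(\mathbf{x};q,0)=\sum_{F\in\mathrm{InvFree}(\alpha,\sigma)}\mathbf{x}^Fq^{\mathrm{maj}(F)}$, and $\tilde{\mathrm{H}}_\lambda(\mathbf{x};q,0)=\tilde{\mathrm{H}}^{w_0}_\lambda(\mathbf{x};q,0)$. *)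

theory Defs
  imports
    "HOL-Library.Multiset"
    "HOL-Library.FuncSet"
    "HOL-Library.Poly_Mapping"
    "HOL-Combinatorics.Permutations"
    "HOL-Computational_Algebra.Polynomial"
begin

text \<open>
  Sequences of length \<open>n\<close> are functions \<open>nat \<Rightarrow> nat\<close>, of which only the values on \<open>{1..n}\<close> matter.
\<close>

definition perm_seq :: "(nat \<Rightarrow> nat) \<Rightarrow> (nat \<Rightarrow> 'a) \<Rightarrow> nat \<Rightarrow> 'a" where
  "perm_seq \<tau> a = (\<lambda>i. a (inv \<tau> i))"

definition w0 :: "nat \<Rightarrow> nat \<Rightarrow> nat" where
  "w0 n = (\<lambda>i. n + 1 - i)"

definition is_partition :: "nat \<Rightarrow> (nat \<Rightarrow> nat) \<Rightarrow> bool" where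
  "is_partition n lam \<longleftrightarrow> (\<forall>i j. 1 \<le> i \<and> i \<le> j \<and> j \<le> n \<longrightarrow> lam j \<le> lam i)"

text \<open>
  \<open>BigInf i\<close> is the basement symbol \<open>\<infinity>\<^sub>i\<close>; \<open>Val m\<close> is the ordinary entry \<open>m\<close>
  (positivity of \<open>m\<close> is imposed in \<open>fillings\<close>).
\<close>

datatype entry = Val (the_val: nat) | BigInf nat

instantiation entry :: linorder
begin

fun less_eq_entry :: "entry \<Rightarrow> entry \<Rightarrow> bool" where
  "less_eq_entry (Val m) (Val k) \<longleftrightarrow> m \<le> k"
| "less_eq_entry (Val m) (BigInf j) \<longleftrightarrow> True"
| "less_eq_entry (BigInf i) (Val k) \<longleftrightarrow> False"
| "less_eq_entry (BigInf i) (BigInf j) \<longleftrightarrow> i \<le> j"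

definition less_entry :: "entry \<Rightarrow> entry \<Rightarrow> bool" where
  "less_entry x y \<longleftrightarrow> x \<le> y \<and> \<not> y \<le> x"

instance
proof
  fix x y z :: entry
  show "x < y \<longleftrightarrow> x \<le> y \<and> \<not> y \<le> x" by (rule less_entry_def)
  show "x \<le> x" by (cases x) auto
  show "x \<le> y \<Longrightarrow> y \<le> z \<Longrightarrow> x \<le> z" by (cases x; cases y; cases z) auto
  show "x \<le> y \<Longrightarrow> y \<le> x \<Longrightarrow> x = y" by (cases x; cases y) auto
  show "x \<le> y \<or> y \<le> x" by (cases x; cases y) auto
qed

end

lemma less_entry_simps [simp]:
  "Val m < Val k \<longleftrightarrow> m < k"
  "Val m < BigInf j"
  "\<not> BigInf i < Val k"
  "BigInf i < BigInf j \<longleftrightarrow> i < j"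
  by (auto simp: less_entry_def)

type_synonym box = "nat \<times> nat"

definition diagram :: "nat \<Rightarrow> (nat \<Rightarrow> nat) \<Rightarrow> box set" where
  "diagram n \<alpha> = {(r, j). 1 \<le> r \<and> r \<le> n \<and> 1 \<le> j \<and> j \<le> \<alpha> r}"

definition aug_diagram :: "nat \<Rightarrow> (nat \<Rightarrow> nat) \<Rightarrow> box set" where
  "aug_diagram n \<alpha> = {(r, j). 1 \<le> r \<and> r \<le> n \<and> j \<le> \<alpha> r}"

text \<open>
  Fillings are \<open>extensional\<close>, so that a filling is determined by its entries in the augmented diagram.
\<close>

definition fillings :: "nat \<Rightarrow> (nat \<Rightarrow> nat) \<Rightarrow> (nat \<Rightarrow> nat) \<Rightarrow> (box \<Rightarrow> entry) set" where
  "fillings n \<alpha> \<sigma> =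
     {F \<in> extensional (aug_diagram n \<alpha>).
        (\<forall>r\<in>{1..n}. F (r, 0) = BigInf (\<sigma> r)) \<and>
        (\<forall>u\<in>diagram n \<alpha>. \<exists>m\<ge>1. F u = Val m)}"

definition type_A_triple :: "nat \<Rightarrow> (nat \<Rightarrow> nat) \<Rightarrow> box \<Rightarrow> box \<Rightarrow> box \<Rightarrow> bool" where
  "type_A_triple n \<alpha> a b c \<longleftrightarrow>
     {a, b, c} \<subseteq> aug_diagram n \<alpha> \<and>
     (\<exists>r j k. j \<ge> 1 \<and> k > r \<and> \<alpha> r \<ge> \<alpha> k \<and>
        a = (r, j - 1) \<and> b = (r, j) \<and> c = (k, j))"

definition type_B_triple :: "nat \<Rightarrow> (nat \<Rightarrow> nat) \<Rightarrow> box \<Rightarrow> box \<Rightarrow> box \<Rightarrow> bool" where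
  "type_B_triple n \<alpha> a b c \<longleftrightarrow>
     {a, b, c} \<subseteq> aug_diagram n \<alpha> \<and>
     (\<exists>r j k. j \<ge> 1 \<and> k < r \<and> \<alpha> r > \<alpha> k \<and>
        a = (r, j - 1) \<and> b = (r, j) \<and> c = (k, j - 1))"

text \<open>
  \<open>sort_key\<close> is stable, so sorting the list \<open>[b, c, a]\<close> by entries lists the three boxes in
  increasing order with ties broken by regarding \<open>a\<close> as largest, then \<open>c\<close>, then \<open>b\<close>.
\<close>

definition increasing_order :: "(box \<Rightarrow> entry) \<Rightarrow> box \<Rightarrow> box \<Rightarrow> box \<Rightarrow> box list" where
  "increasing_order F a b c = sort_key F [b, c, a]"

definition inversion_A :: "(box \<Rightarrow> entry) \<Rightarrow> box \<Rightarrow> box \<Rightarrow> box \<Rightarrow> bool" where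
  "inversion_A F a b c \<longleftrightarrow> (\<exists>i. increasing_order F a b c = rotate i [a, c, b])"

definition inversion_B :: "(box \<Rightarrow> entry) \<Rightarrow> box \<Rightarrow> box \<Rightarrow> box \<Rightarrow> bool" where
  "inversion_B F a b c \<longleftrightarrow> (\<exists>i. increasing_order F a b c = rotate i [c, b, a])"

definition InvFree :: "nat \<Rightarrow> (nat \<Rightarrow> nat) \<Rightarrow> (nat \<Rightarrow> nat) \<Rightarrow> (box \<Rightarrow> entry) set" where
  "InvFree n \<alpha> \<sigma> =
     {F \<in> fillings n \<alpha> \<sigma>.
        (\<forall>a b c. type_A_triple n \<alpha> a b c \<longrightarrow> \<not> inversion_A F a b c) \<and>
        (\<forall>a b c. type_B_triple n \<alpha> a b c \<longrightarrow> \<not> inversion_B F a b c)}"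

definition descents :: "nat \<Rightarrow> (nat \<Rightarrow> nat) \<Rightarrow> (box \<Rightarrow> entry) \<Rightarrow> box set" where
  "descents n \<alpha> F = {(r, j) \<in> diagram n \<alpha>. F (r, j - 1) < F (r, j)}"

definition leg :: "(nat \<Rightarrow> nat) \<Rightarrow> box \<Rightarrow> nat" where
  "leg \<alpha> = (\<lambda>(r, j). \<alpha> r - j)"

definition maj :: "nat \<Rightarrow> (nat \<Rightarrow> nat) \<Rightarrow> (box \<Rightarrow> entry) \<Rightarrow> nat" where
  "maj n \<alpha> F = (\<Sum>b\<in>descents n \<alpha> F. leg \<alpha> b + 1)"

definition column_set :: "nat \<Rightarrow> (nat \<Rightarrow> nat) \<Rightarrow> (box \<Rightarrow> entry) \<Rightarrow> nat \<Rightarrow> entry multiset" where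
  "column_set n \<alpha> F j = image_mset F (mset_set {u \<in> diagram n \<alpha>. snd u = j})"

text \<open>
  A monomial in \<open>x\<^sub>1, x\<^sub>2, \<dots>\<close> is represented by its finitely supported exponent vector, so that
  the product of the \<open>x\<^bsub>F(u)\<^esub>\<close> becomes a sum. A formal power series in \<open>x\<^sub>1, x\<^sub>2, \<dots>\<close> over
  \<open>\<int>[q]\<close> is represented by the function sending each monomial to its coefficient.
\<close>

definition content_monom :: "nat \<Rightarrow> (nat \<Rightarrow> nat) \<Rightarrow> (box \<Rightarrow> entry) \<Rightarrow> (nat \<Rightarrow>\<^sub>0 nat)" where
  "content_monom n \<alpha> F = (\<Sum>u\<in>diagram n \<alpha>. Poly_Mapping.single (the_val (F u)) 1)"

definition Htilde :: "nat \<Rightarrow> (nat \<Rightarrow> nat) \<Rightarrow> (nat \<Rightarrow> nat) \<Rightarrow> (nat \<Rightarrow>\<^sub>0 nat) \<Rightarrow> int poly" where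
  "Htilde n \<sigma> \<alpha> =
     (\<lambda>m. \<Sum>F | F \<in> InvFree n \<alpha> \<sigma> \<and> content_monom n \<alpha> F = m. monom 1 (maj n \<alpha> F))"

definition Htilde_part :: "nat \<Rightarrow> (nat \<Rightarrow> nat) \<Rightarrow> (nat \<Rightarrow>\<^sub>0 nat) \<Rightarrow> int poly" where
  "Htilde_part n lam = Htilde n (w0 n) lam"

lemma finite_aug_diagram: "finite (aug_diagram n \<alpha>)"
proof -
  have "aug_diagram n \<alpha> = (SIGMA r:{1..n}. {..\<alpha> r})"
    by (auto simp: aug_diagram_def)
  then show ?thesis by simp
qed

lemma diagram_subset: "diagram n \<alpha> \<subseteq> aug_diagram n \<alpha>"
  by (auto simp: diagram_def aug_diagram_def)

lemma finite_diagram: "finite (diagram n \<alpha>)"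
  using finite_subset[OF diagram_subset finite_aug_diagram] .

text \<open>Every coefficient of \<open>Htilde\<close> is a finite sum.\<close>

lemma finite_InvFree_content:
  "finite {F. F \<in> InvFree n \<alpha> \<sigma> \<and> content_monom n \<alpha> F = m}" (is "finite ?S")
proof -
  let ?V = "BigInf ` \<sigma> ` {1..n} \<union> Val ` Poly_Mapping.keys m"
  have "?S \<subseteq> PiE (aug_diagram n \<alpha>) (\<lambda>_. ?V)"
  proof (intro subsetI PiE_I)
    fix F u
    assume "F \<in> ?S" and u: "u \<in> aug_diagram n \<alpha>"
    then have F: "F \<in> fillings n \<alpha> \<sigma>" and m: "content_monom n \<alpha> F = m"
      by (auto simp: InvFree_def)
    show "F u \<in> ?V"
    proof (cases "u \<in> diagram n \<alpha>")
      case True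
      then obtain k where k: "F u = Val k" using F by (auto simp: fillings_def)
      have "Poly_Mapping.lookup m k = (\<Sum>v\<in>diagram n \<alpha>. if the_val (F v) = k then 1 else 0)"
        unfolding m[symmetric] content_monom_def
        by (simp add: lookup_sum lookup_single when_def cong: if_cong)
      also have "\<dots> \<ge> (\<Sum>v\<in>{u}. if the_val (F v) = k then 1 else 0)"
        by (rule sum_mono2) (use True finite_diagram in auto)
      finally have "Poly_Mapping.lookup m k \<noteq> 0" using k by simp
      then show ?thesis using k by (simp add: in_keys_iff)
    next
      case False
      then obtain r where "u = (r, 0)" "r \<in> {1..n}"
        using u by (cases u) (auto simp: diagram_def aug_diagram_def)
      then show ?thesis using F by (auto simp: fillings_def)
    qed
  next
    fix F u
    assume "F \<in> ?S" and "u \<notin> aug_diagram n \<alpha>"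
    then show "F u = undefined"
      by (cases u) (auto simp: InvFree_def fillings_def extensional_def)
  qed
  then show ?thesis
    by (rule finite_subset) (intro finite_PiE finite_aug_diagram, auto)
qed

end

theory Submission
  imports Defs
begin

text \<open>
  For both types of triples, being inversion-free means that the third entry avoids the cyclic
  interval from the first entry up to the second, so a filling is inversion-free iff a condition
  on pairs of rows holds. It suffices to exchange two adjacent rows. If they have
  different lengths, keep all other rows and, in each column, the pair of entries of the two rows:
  with the longer row on top, its entries are forced from left to right (cyclic successors), with
  the longer row below they are forced from right to left (cyclic predecessors), so each filling
  has exactly one partner. An invariant on the columns where the pair is exchanged shows that
  the conditions involving a third row survive, and counting how often the longer row winds
  around the cyclic order shows that the major index does not change. If the lengths agree, only
  the basement labels move, and these do not matter as long as longer rows have larger labels.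
\<close>

section \<open>Cyclic order and swapped pairs\<close>

text \<open>
  Going up cyclically from \<open>a\<close> to \<open>b\<close>, one does not meet \<open>c\<close> strictly in between;
  the way from \<open>a\<close> to \<open>a\<close> is a full turn.
\<close>

definition cyc :: "'a::linorder \<Rightarrow> 'a \<Rightarrow> 'a \<Rightarrow> bool" where
  "cyc a b c \<longleftrightarrow> (if a < b then \<not> (a < c \<and> c < b) else \<not> c < b \<and> \<not> a < c)"

definition same_pair :: "'a \<Rightarrow> 'a \<Rightarrow> 'a \<Rightarrow> 'a \<Rightarrow> bool" where
  "same_pair l s l' s' \<longleftrightarrow> l' = l \<and> s' = s \<or> l' = s \<and> s' = l"

lemma same_pair_sym: "same_pair l s l' s' \<longleftrightarrow> same_pair l' s' l s"
  by (auto simp: same_pair_def)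

text \<open>For fixed \<open>b\<close>, \<open>cyc a b c\<close> says that the way up from
  \<open>a\<close> to \<open>b\<close> is at most as long as the way from \<open>c\<close>.
  Distances are compared linearly, so one of two candidates always qualifies.\<close>

lemma cyc_total_left: "cyc a b c \<or> cyc c b a"
  by (auto simp: cyc_def)

text \<open>Likewise with the starting point fixed: one of two candidates is met no later than the
  other.\<close>

lemma cyc_total_right: "cyc a b c \<or> cyc a c b"
  by (auto simp: cyc_def)

text \<open>Antisymmetry of the comparison of distances: if both choices for the longer row are
  admissible, the two entries coincide.\<close>

lemma same_pair_unique_left:
  assumes "same_pair l s l1 s1" "same_pair l s l2 s2" "cyc l1 b s1" "cyc l2 b s2"
  shows "l1 = l2 \<and> s1 = s2"
  using assms unfolding same_pair_def cyc_def by (auto split: if_splits)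

lemma same_pair_unique_right:
  assumes "same_pair l s l1 s1" "same_pair l s l2 s2" "cyc a l1 s1" "cyc a l2 s2"
  shows "l1 = l2 \<and> s1 = s2"
  using assms unfolding same_pair_def cyc_def by (auto split: if_splits)

text \<open>
  In the following steps the letters \<open>l\<close>, \<open>s\<close>, \<open>x\<close> stand for entries of the longer row, the shorter
  row and a third row; the index \<open>0\<close> marks the previous column and the prime the rows after the exchange.
\<close>

lemma swap_third_entry:
  assumes "same_pair l\<^sub>0 s\<^sub>0 l\<^sub>0' s\<^sub>0'" "same_pair l s l' s'" "cyc l\<^sub>0 l s" "cyc l\<^sub>0' l' s\<^sub>0'"
  shows "cyc l\<^sub>0 l x \<and> cyc s\<^sub>0 s x \<longleftrightarrow> cyc l\<^sub>0' l' x \<and> cyc s\<^sub>0' s' x"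
  using assms unfolding same_pair_def cyc_def by (auto split: if_splits)

text \<open>For a third row below, longer than the shorter row and at most as long as the longer
  one. The second assumption carries the invariant of column \<open>Suc j\<close>, the first
  conjunct of the conclusion that of column \<open>j\<close>: it moves left.\<close>

lemma swap_below_step:
  assumes "same_pair l\<^sub>0 s\<^sub>0 l\<^sub>0' s\<^sub>0'" "l' = l \<or> l' = s \<and> cyc l\<^sub>0 l s \<and> \<not> cyc x s l" "cyc l\<^sub>0' l' s\<^sub>0'"
    "cyc l\<^sub>0 l x" "cyc x\<^sub>0 x s\<^sub>0"
  shows "(l\<^sub>0' = l\<^sub>0 \<or> \<not> cyc x\<^sub>0 s\<^sub>0 l\<^sub>0) \<and> cyc l\<^sub>0' l' x \<and> cyc x\<^sub>0 x s\<^sub>0'"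
  using assms unfolding same_pair_def cyc_def by (auto split: if_splits)

text \<open>The converse passage, in which the invariant moves one column to the right.\<close>

lemma unswap_below_step:
  assumes "same_pair l\<^sub>0 s\<^sub>0 l\<^sub>0' s\<^sub>0'" "l' = l \<or> l' = s \<and> cyc l\<^sub>0 l s" "cyc l\<^sub>0' l' s\<^sub>0'"
    "cyc l\<^sub>0' l' x" "cyc x\<^sub>0 x s\<^sub>0'" "l\<^sub>0' = l\<^sub>0 \<or> \<not> cyc x\<^sub>0 s\<^sub>0 l\<^sub>0"
  shows "(l' = l \<or> \<not> cyc x s l) \<and> cyc l\<^sub>0 l x \<and> cyc x\<^sub>0 x s\<^sub>0"
  using assms unfolding same_pair_def cyc_def by (auto split: if_splits)

text \<open>For a third row above, at least as long as the shorter row and shorter than the longer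
  one. Again the invariant moves left.\<close>

lemma swap_above_step:
  assumes "same_pair l\<^sub>0 s\<^sub>0 l\<^sub>0' s\<^sub>0'" "same_pair l s l' s'" "cyc l\<^sub>0 l s" "l' = l \<or> \<not> cyc l x s"
    "cyc l\<^sub>0' l' s\<^sub>0'" "cyc l\<^sub>0 l x\<^sub>0" "cyc x\<^sub>0 x s"
  shows "(l\<^sub>0' = l\<^sub>0 \<or> \<not> cyc l\<^sub>0 x\<^sub>0 s\<^sub>0) \<and> cyc l\<^sub>0' l' x\<^sub>0 \<and> cyc x\<^sub>0 x s'"
  using assms unfolding same_pair_def cyc_def by (auto split: if_splits)

lemma unswap_above_step:
  assumes "same_pair l\<^sub>0 s\<^sub>0 l\<^sub>0' s\<^sub>0'" "same_pair l s l' s'" "cyc l\<^sub>0 l s" "cyc l\<^sub>0' l' s\<^sub>0'"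
    "cyc l\<^sub>0' l' x\<^sub>0" "cyc x\<^sub>0 x s'" "l\<^sub>0' = l\<^sub>0 \<or> \<not> cyc l\<^sub>0 x\<^sub>0 s\<^sub>0"
  shows "(l' = l \<or> \<not> cyc l x s) \<and> cyc l\<^sub>0 l x\<^sub>0 \<and> cyc x\<^sub>0 x s"
  using assms unfolding same_pair_def cyc_def by (auto split: if_splits)

text \<open>The last column of the shorter row, where the right neighbour \<open>l\<close> in the
  longer row is not subject to exchange.\<close>

lemma swap_above_last:
  assumes "same_pair l\<^sub>0 s\<^sub>0 l\<^sub>0' s\<^sub>0'" "cyc l\<^sub>0' l s\<^sub>0'" "cyc l\<^sub>0 l x\<^sub>0"
  shows "(l\<^sub>0' = l\<^sub>0 \<or> \<not> cyc l\<^sub>0 x\<^sub>0 s\<^sub>0) \<and> cyc l\<^sub>0' l x\<^sub>0"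
  using assms unfolding same_pair_def cyc_def by (auto split: if_splits)

lemma unswap_above_last:
  assumes "same_pair l\<^sub>0 s\<^sub>0 l\<^sub>0' s\<^sub>0'" "cyc l\<^sub>0' l s\<^sub>0'" "cyc l\<^sub>0' l x\<^sub>0" "l\<^sub>0' = l\<^sub>0 \<or> \<not> cyc l\<^sub>0 x\<^sub>0 s\<^sub>0"
  shows "cyc l\<^sub>0 l x\<^sub>0"
  using assms unfolding same_pair_def cyc_def by (auto split: if_splits)

text \<open>A step is a descent iff its way up does not pass the top of the order. If exactly one of
  the two columns is exchanged, both matchings run over the same arcs with the same multiplicity, so
  they pass the top equally often.\<close>

lemma swap_descents_pair:
  assumes "same_pair l\<^sub>0 s\<^sub>0 l\<^sub>0' s\<^sub>0'" "same_pair l s l' s'" "cyc l\<^sub>0 l s" "cyc l\<^sub>0' l' s\<^sub>0'"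
  shows "of_bool (l\<^sub>0 < l) + of_bool (s\<^sub>0 < s) = (of_bool (l\<^sub>0' < l') + of_bool (s\<^sub>0' < s') :: nat)"
  using assms unfolding same_pair_def cyc_def of_bool_def by (auto split: if_splits)

text \<open>The correction terms \<open>l' < l\<close> telescope along the row.\<close>

lemma swap_descents_long:
  assumes "same_pair l\<^sub>0 s\<^sub>0 l\<^sub>0' s\<^sub>0'" "l' = l \<or> l' = s \<and> cyc l\<^sub>0 l s" "cyc l\<^sub>0' l' s\<^sub>0'"
  shows "of_bool (l\<^sub>0 < l) + of_bool (l\<^sub>0' < l\<^sub>0) = (of_bool (l\<^sub>0' < l') + of_bool (l' < l) :: nat)"
  using assms unfolding same_pair_def cyc_def of_bool_def by (auto split: if_splits)

section \<open>Swapping two rows\<close>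

text \<open>\<open>x\<close> is the upper row. The first branch collects the type A triples of the
  two rows; in the second the lower row is strictly longer and the triples have type B.\<close>

definition row_ok :: "nat \<Rightarrow> (nat \<Rightarrow> 'a::linorder) \<Rightarrow> nat \<Rightarrow> (nat \<Rightarrow> 'a) \<Rightarrow> bool" where
  "row_ok p x q y \<longleftrightarrow>
     (if q \<le> p then \<forall>j<q. cyc (x j) (x (Suc j)) (y (Suc j))
      else \<forall>j\<le>p. cyc (y j) (y (Suc j)) (x j))"

text \<open>The index \<open>j\<close> belongs to the left neighbour: a descent in column
  \<open>Suc j\<close> has leg \<open>p - Suc j\<close>, hence weight \<open>p - j\<close>.\<close>

definition row_maj :: "nat \<Rightarrow> (nat \<Rightarrow> 'a::linorder) \<Rightarrow> nat" where
  "row_maj p x = (\<Sum>j<p. of_bool (x j < x (Suc j)) * (p - j))"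

text \<open>\<open>L\<close> and \<open>L'\<close> are the longer row before and after the rows
  trade places. The basement label travels with its row, so column 0 is not exchanged.\<close>

definition swapped_rows ::
  "nat \<Rightarrow> (nat \<Rightarrow> 'a) \<Rightarrow> (nat \<Rightarrow> 'a) \<Rightarrow> (nat \<Rightarrow> 'a) \<Rightarrow> (nat \<Rightarrow> 'a) \<Rightarrow> bool" where
  "swapped_rows q L S L' S' \<longleftrightarrow>
     L' 0 = L 0 \<and> S' 0 = S 0 \<and> (\<forall>j. same_pair (L j) (S j) (L' j) (S' j)) \<and>
     (\<forall>j>q. L' j = L j \<and> S' j = S j)"

lemma swapped_rows_sym: "swapped_rows q L S L' S' \<longleftrightarrow> swapped_rows q L' S' L S"
  by (auto simp: swapped_rows_def same_pair_sym)

definition long_above :: "nat \<Rightarrow> (nat \<Rightarrow> 'a::linorder) \<Rightarrow> (nat \<Rightarrow> 'a) \<Rightarrow> bool" where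
  "long_above q L S \<longleftrightarrow> (\<forall>j<q. cyc (L j) (L (Suc j)) (S (Suc j)))"

definition long_below :: "nat \<Rightarrow> (nat \<Rightarrow> 'a::linorder) \<Rightarrow> (nat \<Rightarrow> 'a) \<Rightarrow> bool" where
  "long_below q L S \<longleftrightarrow> (\<forall>j\<le>q. cyc (L j) (L (Suc j)) (S j))"

section \<open>Existence and uniqueness of the exchanged pair of rows\<close>

text \<open>Built from right to left, starting at column \<open>Suc q\<close>, which belongs to the
  longer row only. The assumptions describe basement entries that dominate the first column, the
  larger one in the longer row.\<close>

lemma exists_long_below:
  assumes "S 0 \<le> L 0" "L 1 \<le> S 0" "0 < q \<Longrightarrow> S 1 \<le> S 0"
  shows "\<exists>L' S'. swapped_rows q L S L' S' \<and> long_below q L' S'"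
proof -
  have "1 \<le> Suc q" by simp
  then have "\<exists>L' S'. (\<forall>j. j < 1 \<or> q < j \<longrightarrow> L' j = L j \<and> S' j = S j) \<and>
      (\<forall>j. same_pair (L j) (S j) (L' j) (S' j)) \<and>
      (\<forall>j. 1 \<le> j \<and> j \<le> q \<longrightarrow> cyc (L' j) (L' (Suc j)) (S' j))"
  proof (induction rule: inc_induct)
    case base
    show ?case by (intro exI[of _ L] exI[of _ S]) (auto simp: same_pair_def)
  next
    case (step k)
    then obtain L' S' where *: "\<And>j. j < Suc k \<or> q < j \<Longrightarrow> L' j = L j \<and> S' j = S j"
      "\<And>j. same_pair (L j) (S j) (L' j) (S' j)"
      "\<And>j. Suc k \<le> j \<Longrightarrow> j \<le> q \<Longrightarrow> cyc (L' j) (L' (Suc j)) (S' j)"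
      by blast
    \<comment> \<open>The longer row receives the entry of column \<open>k\<close> with the shorter
      way up to \<open>L' (Suc k)\<close>.\<close>
    show ?case
    proof (cases "cyc (L k) (L' (Suc k)) (S k)")
      case True
      show ?thesis
      proof (rule exI[of _ L'], rule exI[of _ S'], intro conjI allI impI)
        fix j assume "k \<le> j \<and> j \<le> q"
        then show "cyc (L' j) (L' (Suc j)) (S' j)"
          using *(1)[of k] *(3)[of j] True by (cases "j = k") auto
      qed (use *(1,2) in auto)
    next
      case False
      then have c: "cyc (S k) (L' (Suc k)) (L k)" using cyc_total_left by blast
      show ?thesis
      proof (rule exI[of _ "L'(k := S k)"], rule exI[of _ "S'(k := L k)"], intro conjI allI impI)
        fix j assume "k \<le> j \<and> j \<le> q"
        then show "cyc ((L'(k := S k)) j) ((L'(k := S k)) (Suc j)) ((S'(k := L k)) j)"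
          using *(3)[of j] c by (cases "j = k") auto
      qed (use * step.hyps in \<open>auto simp: same_pair_def\<close>)
    qed
  qed
  then obtain L' S' where *: "\<And>j. j < 1 \<or> q < j \<Longrightarrow> L' j = L j \<and> S' j = S j"
      "\<And>j. same_pair (L j) (S j) (L' j) (S' j)"
      "\<And>j. 1 \<le> j \<Longrightarrow> j \<le> q \<Longrightarrow> cyc (L' j) (L' (Suc j)) (S' j)"
    by blast
  \<comment> \<open>Column 0 leaves no choice: its condition holds because either candidate for
    \<open>L' 1\<close> is at most \<open>S 0\<close>, which is at most \<open>L 0\<close>.\<close>
  have "L' 1 \<le> S 0"
    using *(1)[of 1] *(2)[of 1] assms(2,3) by (cases "q = 0") (auto simp: same_pair_def)
  then have "cyc (L' 0) (L' 1) (S' 0)"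
    using *(1)[of 0] assms(1) by (auto simp: cyc_def)
  then have "cyc (L' j) (L' (Suc j)) (S' j)" if "j \<le> q" for j
    using *(3)[of j] that by (cases j) auto
  then show ?thesis
    using * by (intro exI[of _ L'] exI[of _ S']) (auto simp: swapped_rows_def long_below_def)
qed

text \<open>Built from left to right, starting from the fixed column 0: of the two entries in the
  next column, the longer row takes the one met first.\<close>

lemma exists_long_above:
  "\<exists>L' S'. swapped_rows q L S L' S' \<and> long_above q L' S'"
proof -
  \<comment> \<open>Columns beyond \<open>k\<close> are still unexchanged, so the choice in column
    \<open>Suc k\<close> is open; \<open>k = q\<close> is the claim.\<close>
  have "\<exists>L' S'. (\<forall>j. j = 0 \<or> k < j \<longrightarrow> L' j = L j \<and> S' j = S j) \<and>
      (\<forall>j. same_pair (L j) (S j) (L' j) (S' j)) \<and>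
      (\<forall>j<k. cyc (L' j) (L' (Suc j)) (S' (Suc j)))" for k
  proof (induction k)
    case 0
    show ?case by (intro exI[of _ L] exI[of _ S]) (auto simp: same_pair_def)
  next
    case (Suc k)
    then obtain L' S' where *: "\<And>j. j = 0 \<or> k < j \<Longrightarrow> L' j = L j \<and> S' j = S j"
      "\<And>j. same_pair (L j) (S j) (L' j) (S' j)"
      "\<And>j. j < k \<Longrightarrow> cyc (L' j) (L' (Suc j)) (S' (Suc j))"
      by blast
    show ?case
    proof (cases "cyc (L' k) (L (Suc k)) (S (Suc k))")
      case True
      show ?thesis
      proof (rule exI[of _ L'], rule exI[of _ S'], intro conjI allI impI)
        fix j assume "j < Suc k"
        then show "cyc (L' j) (L' (Suc j)) (S' (Suc j))"
          using *(1)[of "Suc k"] *(3)[of j] True by (cases "j = k") auto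
      qed (use *(1,2) in auto)
    next
      case False
      then have c: "cyc (L' k) (S (Suc k)) (L (Suc k))" using cyc_total_right by blast
      show ?thesis
      proof (rule exI[of _ "L'(Suc k := S (Suc k))"], rule exI[of _ "S'(Suc k := L (Suc k))"],
          intro conjI allI impI)
        fix j assume "j < Suc k"
        then show "cyc ((L'(Suc k := S (Suc k))) j) ((L'(Suc k := S (Suc k))) (Suc j))
            ((S'(Suc k := L (Suc k))) (Suc j))"
          using *(3)[of j] c by (cases "j = k") auto
      qed (use *(1,2) in \<open>auto simp: same_pair_def\<close>)
    qed
  qed
  from this[of q] show ?thesis
    by (auto simp: swapped_rows_def long_above_def)
qed

lemma long_below_unique:
  assumes 1: "swapped_rows q L S L1 S1" "long_below q L1 S1"
    and 2: "swapped_rows q L S L2 S2" "long_below q L2 S2"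
  shows "L1 = L2 \<and> S1 = S2"
proof -
  have tail: "L1 j = L2 j \<and> S1 j = S2 j" if "q < j" for j
    using 1 2 that by (auto simp: swapped_rows_def)
  have "L1 j = L2 j \<and> S1 j = S2 j" if "j \<le> Suc q" for j
    using that
  proof (induction rule: inc_induct)
    case base
    show ?case by (rule tail) simp
  next
    case (step k)
    then have "k \<le> q" by simp
    then have "cyc (L1 k) (L1 (Suc k)) (S1 k)" "cyc (L2 k) (L1 (Suc k)) (S2 k)"
      using 1 2 step.IH by (auto simp: long_below_def)
    then show ?case
      using 1 2 same_pair_unique_left unfolding swapped_rows_def by metis
  qed
  then have "L1 j = L2 j \<and> S1 j = S2 j" for j
    using tail by (cases "j \<le> q") auto
  then show ?thesis by auto
qed

lemma long_above_unique:
  assumes 1: "swapped_rows q L S L1 S1" "long_above q L1 S1"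
    and 2: "swapped_rows q L S L2 S2" "long_above q L2 S2"
  shows "L1 = L2 \<and> S1 = S2"
proof -
  have "L1 j = L2 j \<and> S1 j = S2 j" for j
  proof (induction j)
    case 0
    show ?case using 1 2 by (auto simp: swapped_rows_def)
  next
    case (Suc k)
    show ?case
    proof (cases "k < q")
      case True
      then have "cyc (L1 k) (L1 (Suc k)) (S1 (Suc k))" "cyc (L1 k) (L2 (Suc k)) (S2 (Suc k))"
        using 1 2 Suc by (auto simp: long_above_def)
      then show ?thesis
        using 1 2 same_pair_unique_right unfolding swapped_rows_def by metis
    qed (use 1 2 in \<open>auto simp: swapped_rows_def\<close>)
  qed
  then show ?thesis by auto
qed

locale row_swap =
  fixes p q :: nat and L S L' S' :: "nat \<Rightarrow> 'a::linorder"
  assumes shorter: "q < p"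
    and swapped: "swapped_rows q L S L' S'"
    and above: "long_above q L S"
    and below: "long_below q L' S'"
begin

lemma pair: "same_pair (L j) (S j) (L' j) (S' j)"
  using swapped by (auto simp: swapped_rows_def)

lemma pair_cases: "L' j = L j \<and> S' j = S j \<or> L' j = S j \<and> S' j = L j"
  using pair by (auto simp: same_pair_def)

lemma tail: "q < j \<Longrightarrow> L' j = L j" "q < j \<Longrightarrow> S' j = S j"
  using swapped by (auto simp: swapped_rows_def)

lemma start: "L' 0 = L 0" "S' 0 = S 0"
  using swapped by (auto simp: swapped_rows_def)

lemma above_step: "j < q \<Longrightarrow> cyc (L j) (L (Suc j)) (S (Suc j))"
  using above by (auto simp: long_above_def)

lemma below_step: "j \<le> q \<Longrightarrow> cyc (L' j) (L' (Suc j)) (S' j)"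
  using below by (auto simp: long_below_def)

text \<open>For \<open>j = q\<close> the next column lies beyond the shorter row and only the first
  alternative occurs. This form lets one step lemma cover that column too.\<close>

lemma next_cases:
  "j \<le> q \<Longrightarrow> L' (Suc j) = L (Suc j) \<or> L' (Suc j) = S (Suc j) \<and> cyc (L j) (L (Suc j)) (S (Suc j))"
  using above_step[of j] tail(1)[of "Suc j"] pair_cases[of "Suc j"] by (cases "j = q") auto

section \<open>Conditions involving a third row\<close>

lemma third_row_below_middle:
  assumes "q < m" "m \<le> p"
  shows "row_ok p L m X \<and> row_ok q S m X \<longleftrightarrow> row_ok p L' m X \<and> row_ok q S' m X"
    (is "?l \<longleftrightarrow> ?r")
proof -
  have l: "?l \<longleftrightarrow> (\<forall>j<m. cyc (L j) (L (Suc j)) (X (Suc j))) \<and> (\<forall>j\<le>q. cyc (X j) (X (Suc j)) (S j))"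
    and r: "?r \<longleftrightarrow> (\<forall>j<m. cyc (L' j) (L' (Suc j)) (X (Suc j))) \<and> (\<forall>j\<le>q. cyc (X j) (X (Suc j)) (S' j))"
    using assms by (auto simp: row_ok_def)
  \<comment> \<open>In an exchanged column, \<open>L\<close>, \<open>S\<close>, \<open>X\<close> occur in this cyclic order, where a tie of \<open>X\<close> is
    allowed with \<open>S\<close> only.\<close>
  define I where "I j \<longleftrightarrow> L' j = L j \<or> \<not> cyc (X j) (S j) (L j)" for j
  show ?thesis
  proof
    assume ?l
    then have *: "\<And>j. j < m \<Longrightarrow> cyc (L j) (L (Suc j)) (X (Suc j))"
      "\<And>j. j \<le> q \<Longrightarrow> cyc (X j) (X (Suc j)) (S j)"
      using l by auto
    have step: "I j \<and> cyc (L' j) (L' (Suc j)) (X (Suc j)) \<and> cyc (X j) (X (Suc j)) (S' j)"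
      if "I (Suc j)" "j \<le> q" for j
      unfolding I_def
      by (rule swap_below_step[where s = "S (Suc j)", OF pair _ below_step])
        (use that * assms next_cases[of j] in \<open>auto simp: I_def\<close>)
    \<comment> \<open>The invariant travels left from column \<open>Suc q\<close>, where nothing is
      exchanged.\<close>
    have I: "I j" if "j \<le> Suc q" for j
      using that
    proof (induction rule: inc_induct)
      case base
      show ?case using tail by (auto simp: I_def)
    next
      case (step k)
      then show ?case using \<open>\<And>j. I (Suc j) \<Longrightarrow> j \<le> q \<Longrightarrow> _\<close>[of k] by auto
    qed
    show ?r
      unfolding r
    proof (intro conjI allI impI)
      fix j assume "j < m"
      then show "cyc (L' j) (L' (Suc j)) (X (Suc j))"
        using step[OF I, of j] *(1)[of j] tail(1)[of j] tail(1)[of "Suc j"] by (cases "j \<le> q") auto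
    qed (use step[OF I] in auto)
  next
    assume ?r
    then have *: "\<And>j. j < m \<Longrightarrow> cyc (L' j) (L' (Suc j)) (X (Suc j))"
      "\<And>j. j \<le> q \<Longrightarrow> cyc (X j) (X (Suc j)) (S' j)"
      using r by auto
    have step: "I (Suc j) \<and> cyc (L j) (L (Suc j)) (X (Suc j)) \<and> cyc (X j) (X (Suc j)) (S j)"
      if "I j" "j \<le> q" for j
      unfolding I_def
      by (rule unswap_below_step[OF pair next_cases below_step])
        (use that * assms in \<open>auto simp: I_def\<close>)
    \<comment> \<open>Here it travels right from the basement, which is fixed.\<close>
    have I: "I j" if "j \<le> Suc q" for j
      using that
    proof (induction j)
      case 0
      show ?case using start by (auto simp: I_def)
    next
      case (Suc k)
      then show ?case using step[of k] by auto
    qed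
    show ?l
      unfolding l
    proof (intro conjI allI impI)
      fix j assume "j < m"
      then show "cyc (L j) (L (Suc j)) (X (Suc j))"
        using step[OF I, of j] *(1)[of j] tail(1)[of j] tail(1)[of "Suc j"] by (cases "j \<le> q") auto
    qed (use step[OF I] in auto)
  qed
qed

lemma third_row_above_middle:
  assumes "q \<le> m" "m < p"
  shows "row_ok m X p L \<and> row_ok m X q S \<longleftrightarrow> row_ok m X p L' \<and> row_ok m X q S'"
    (is "?l \<longleftrightarrow> ?r")
proof -
  have l: "?l \<longleftrightarrow> (\<forall>j\<le>m. cyc (L j) (L (Suc j)) (X j)) \<and> (\<forall>j<q. cyc (X j) (X (Suc j)) (S (Suc j)))"
    and r: "?r \<longleftrightarrow> (\<forall>j\<le>m. cyc (L' j) (L' (Suc j)) (X j)) \<and> (\<forall>j<q. cyc (X j) (X (Suc j)) (S' (Suc j)))"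
    using assms by (auto simp: row_ok_def)
  have last: "cyc (L' q) (L (Suc q)) (S' q)"
    using below_step[of q] tail(1)[of "Suc q"] by simp
  \<comment> \<open>The same cyclic order, but now a tie of \<open>X\<close> is allowed with \<open>L\<close> only.\<close>
  define I where "I j \<longleftrightarrow> L' j = L j \<or> \<not> cyc (L j) (X j) (S j)" for j
  show ?thesis
  proof
    assume ?l
    then have *: "\<And>j. j \<le> m \<Longrightarrow> cyc (L j) (L (Suc j)) (X j)"
      "\<And>j. j < q \<Longrightarrow> cyc (X j) (X (Suc j)) (S (Suc j))"
      using l by auto
    have step: "I j \<and> cyc (L' j) (L' (Suc j)) (X j) \<and> cyc (X j) (X (Suc j)) (S' (Suc j))"
      if "I (Suc j)" "j < q" for j
      unfolding I_def
      by (rule swap_above_step[OF pair pair above_step _ below_step])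
        (use that * assms in \<open>auto simp: I_def\<close>)
    \<comment> \<open>The condition tying \<open>X\<close> to the shorter row ends in column
      \<open>q\<close>, so the invariant has to start there from the longer row alone.\<close>
    have q: "I q \<and> cyc (L' q) (L (Suc q)) (X q)"
      unfolding I_def by (rule swap_above_last[OF pair last]) (use * assms in auto)
    have I: "I j" if "j \<le> q" for j
      using that
    proof (induction rule: inc_induct)
      case base
      show ?case using q by simp
    next
      case (step k)
      then show ?case using \<open>\<And>j. I (Suc j) \<Longrightarrow> j < q \<Longrightarrow> _\<close>[of k] by auto
    qed
    show ?r
      unfolding r
    proof (intro conjI allI impI)
      fix j assume "j \<le> m"
      then show "cyc (L' j) (L' (Suc j)) (X j)"
        using step[OF I, of j] q *(1)[of j] tail(1)[of j] tail(1)[of "Suc j"]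
        by (cases j q rule: linorder_cases) auto
    qed (use step[OF I] in auto)
  next
    assume ?r
    then have *: "\<And>j. j \<le> m \<Longrightarrow> cyc (L' j) (L' (Suc j)) (X j)"
      "\<And>j. j < q \<Longrightarrow> cyc (X j) (X (Suc j)) (S' (Suc j))"
      using r by auto
    have step: "I (Suc j) \<and> cyc (L j) (L (Suc j)) (X j) \<and> cyc (X j) (X (Suc j)) (S (Suc j))"
      if "I j" "j < q" for j
      unfolding I_def
      by (rule unswap_above_step[OF pair pair above_step below_step])
        (use that * assms in \<open>auto simp: I_def\<close>)
    have I: "I j" if "j \<le> q" for j
      using that
    proof (induction j)
      case 0
      show ?case using start by (auto simp: I_def)
    next
      case (Suc k)
      then show ?case using step[of k] by auto
    qed
    \<comment> \<open>The remaining step leads from column \<open>q\<close> to an entry of the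
      longer row that is not exchanged.\<close>
    have q: "cyc (L q) (L (Suc q)) (X q)"
      by (rule unswap_above_last[OF pair last])
        (use I[of q] *(1)[of q] tail(1)[of "Suc q"] assms in \<open>auto simp: I_def\<close>)
    show ?l
      unfolding l
    proof (intro conjI allI impI)
      fix j assume "j \<le> m"
      then show "cyc (L j) (L (Suc j)) (X j)"
        using step[OF I, of j] q *(1)[of j] tail(1)[of j] tail(1)[of "Suc j"]
        by (cases j q rule: linorder_cases) auto
    qed (use step[OF I] in auto)
  qed
qed

text \<open>If \<open>X\<close> is at most as long as the shorter row, both rows bound arcs avoided
  by the same entry of \<open>X\<close>. If it exceeds the longer row, its own arcs must avoid both
  entries of a column, and exchanging them changes nothing. Only the middle case needs the
  invariant.\<close>

lemma third_row_below:
  "row_ok p L m X \<and> row_ok q S m X \<longleftrightarrow> row_ok p L' m X \<and> row_ok q S' m X"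
proof -
  consider "m \<le> q" | "q < m" "m \<le> p" | "p < m" by linarith
  then show ?thesis
  proof cases
    case 1
    have "cyc (L j) (L (Suc j)) (X (Suc j)) \<and> cyc (S j) (S (Suc j)) (X (Suc j)) \<longleftrightarrow>
      cyc (L' j) (L' (Suc j)) (X (Suc j)) \<and> cyc (S' j) (S' (Suc j)) (X (Suc j))" if "j < m" for j
      by (rule swap_third_entry[OF pair pair above_step below_step]) (use that 1 in auto)
    then show ?thesis using 1 shorter by (auto simp: row_ok_def)
  next
    case 2
    then show ?thesis by (rule third_row_below_middle)
  next
    case 3
    have "(j \<le> p \<longrightarrow> cyc (X j) (X (Suc j)) (L j)) \<and> (j \<le> q \<longrightarrow> cyc (X j) (X (Suc j)) (S j)) \<longleftrightarrow>
      (j \<le> p \<longrightarrow> cyc (X j) (X (Suc j)) (L' j)) \<and> (j \<le> q \<longrightarrow> cyc (X j) (X (Suc j)) (S' j))" for j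
      using shorter pair_cases[of j] tail(1)[of j] by (cases "j \<le> q") auto
    then show ?thesis using 3 shorter by (simp add: row_ok_def) blast
  qed
qed

text \<open>The same division; the bounds shift because rows of equal length form type A
  triples.\<close>

lemma third_row_above:
  "row_ok m X p L \<and> row_ok m X q S \<longleftrightarrow> row_ok m X p L' \<and> row_ok m X q S'"
proof -
  consider "m < q" | "q \<le> m" "m < p" | "p \<le> m" by linarith
  then show ?thesis
  proof cases
    case 1
    have "cyc (L j) (L (Suc j)) (X j) \<and> cyc (S j) (S (Suc j)) (X j) \<longleftrightarrow>
      cyc (L' j) (L' (Suc j)) (X j) \<and> cyc (S' j) (S' (Suc j)) (X j)" if "j \<le> m" for j
      by (rule swap_third_entry[OF pair pair above_step below_step]) (use that 1 in auto)
    then show ?thesis using 1 shorter by (auto simp: row_ok_def)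
  next
    case 2
    then show ?thesis by (rule third_row_above_middle)
  next
    case 3
    have "(j < p \<longrightarrow> cyc (X j) (X (Suc j)) (L (Suc j))) \<and> (j < q \<longrightarrow> cyc (X j) (X (Suc j)) (S (Suc j))) \<longleftrightarrow>
      (j < p \<longrightarrow> cyc (X j) (X (Suc j)) (L' (Suc j))) \<and> (j < q \<longrightarrow> cyc (X j) (X (Suc j)) (S' (Suc j)))" for j
      using shorter pair_cases[of "Suc j"] tail(1)[of "Suc j"] by (cases "j < q") auto
    then show ?thesis using 3 shorter by (simp add: row_ok_def) blast
  qed
qed

section \<open>Major index of the exchanged pair\<close>

text \<open>The correction \<open>L' k < L k\<close> vanishes at \<open>k = 0\<close> and
  \<open>k = Suc q\<close>, where the longer row is unchanged; so its number of descents up to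
  column \<open>Suc q\<close> is preserved.\<close>

lemma descents_long_row:
  assumes "k \<le> Suc q"
  shows "(\<Sum>j<k. of_bool (L j < L (Suc j))) = (\<Sum>j<k. of_bool (L' j < L' (Suc j))) + (of_bool (L' k < L k) :: nat)"
  using assms
proof (induction k)
  case 0
  show ?case by (simp add: start)
next
  case (Suc k)
  have "of_bool (L k < L (Suc k)) + of_bool (L' k < L k)
      = (of_bool (L' k < L' (Suc k)) + of_bool (L' (Suc k) < L (Suc k)) :: nat)"
    by (rule swap_descents_long[OF pair next_cases below_step]) (use Suc.prems in auto)
  then show ?case using Suc by simp
qed

text \<open>Up to column \<open>Suc q\<close>, the weight \<open>p - j\<close> splits as
  \<open>(p - q) + (q - j)\<close>. The first summand weighs the descents of the longer row alone,
  the second those of both rows together; further right nothing changes.\<close>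

lemma row_maj_swap: "row_maj p L + row_maj q S = row_maj p L' + row_maj q S'"
proof -
  have expand: "row_maj p x + row_maj q y =
      (p - q) * (\<Sum>j<Suc q. of_bool (x j < x (Suc j))) +
      (\<Sum>j<q. (q - j) * (of_bool (x j < x (Suc j)) + of_bool (y j < y (Suc j)))) +
      (\<Sum>j\<in>{Suc q..<p}. of_bool (x j < x (Suc j)) * (p - j))" for x y :: "nat \<Rightarrow> 'a"
  proof -
    have "row_maj p x = (\<Sum>j<Suc q. of_bool (x j < x (Suc j)) * (p - j)) +
        (\<Sum>j\<in>{Suc q..<p}. of_bool (x j < x (Suc j)) * (p - j))"
      using shorter sum.atLeastLessThan_concat[of 0 "Suc q" p "\<lambda>j. of_bool (x j < x (Suc j)) * (p - j)"]
      unfolding row_maj_def atLeast0LessThan by linarith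
    also have "(\<Sum>j<Suc q. of_bool (x j < x (Suc j)) * (p - j)) =
        (\<Sum>j<Suc q. (p - q) * of_bool (x j < x (Suc j)) + (q - j) * of_bool (x j < x (Suc j)))"
      by (rule sum.cong) (use shorter in auto)
    also have "\<dots> = (p - q) * (\<Sum>j<Suc q. of_bool (x j < x (Suc j))) +
        (\<Sum>j<q. (q - j) * of_bool (x j < x (Suc j)))"
      by (simp add: sum.distrib sum_distrib_left distrib_left)
    finally show ?thesis
      by (simp add: row_maj_def sum.distrib distrib_left mult.commute)
  qed
  have 1: "(\<Sum>j<Suc q. of_bool (L j < L (Suc j))) = (\<Sum>j<Suc q. of_bool (L' j < L' (Suc j)) :: nat)"
    using descents_long_row[of "Suc q"] by (simp add: tail)
  have 2: "(\<Sum>j<q. (q - j) * (of_bool (L j < L (Suc j)) + of_bool (S j < S (Suc j)))) =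
     (\<Sum>j<q. (q - j) * (of_bool (L' j < L' (Suc j)) + of_bool (S' j < S' (Suc j))))"
  proof (rule sum.cong[OF refl])
    fix j assume "j \<in> {..<q}"
    then have "of_bool (L j < L (Suc j)) + of_bool (S j < S (Suc j))
       = (of_bool (L' j < L' (Suc j)) + of_bool (S' j < S' (Suc j)) :: nat)"
      by (intro swap_descents_pair[OF pair pair above_step below_step]) auto
    then show "(q - j) * (of_bool (L j < L (Suc j)) + of_bool (S j < S (Suc j))) =
       (q - j) * (of_bool (L' j < L' (Suc j)) + of_bool (S' j < S' (Suc j)))" by simp
  qed
  have 3: "(\<Sum>j\<in>{Suc q..<p}. of_bool (L j < L (Suc j)) * (p - j)) =
     (\<Sum>j\<in>{Suc q..<p}. of_bool (L' j < L' (Suc j)) * (p - j))"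
    by (rule sum.cong) (auto simp: tail)
  show ?thesis unfolding expand 1 2 3 ..
qed

end

section \<open>Inversion-free fillings\<close>

lemma ex_rotate3_iff:
  "(\<exists>i. xs = rotate i [a, b, c]) \<longleftrightarrow> xs \<in> {[a, b, c], [b, c, a], [c, a, b]}"
proof
  assume "\<exists>i. xs = rotate i [a, b, c]"
  then obtain i where i: "xs = rotate (i mod 3) [a, b, c]"
    by (metis length_Cons list.size(3) numeral_3_eq_3 rotate_conv_mod)
  have "i mod 3 \<in> {0, 1, 2}" by auto
  then show "xs \<in> {[a, b, c], [b, c, a], [c, a, b]}"
    unfolding i by (auto simp: numeral_2_eq_2)
next
  assume "xs \<in> {[a, b, c], [b, c, a], [c, a, b]}"
  then show "\<exists>i. xs = rotate i [a, b, c]"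
    by (auto intro: exI[of _ 0] exI[of _ 1] exI[of _ 2] simp: numeral_2_eq_2)
qed

text \<open>In the order \<open>a, c, b\<close> both comparisons are strict, since ties list
  \<open>b\<close> before \<open>c\<close> before \<open>a\<close>. So an entry \<open>c\<close>
  equal to an end of the arc causes no inversion, and equal \<open>a\<close> and \<open>b\<close>
  span a full turn, as in \<open>cyc\<close>.\<close>

lemma inversion_A_iff:
  assumes "a \<noteq> b" "b \<noteq> c" "a \<noteq> c"
  shows "inversion_A F a b c \<longleftrightarrow> \<not> cyc (F a) (F b) (F c)"
  using assms unfolding inversion_A_def increasing_order_def ex_rotate3_iff cyc_def by auto

text \<open>\<open>[c, b, a]\<close> is a rotation of \<open>[a, c, b]\<close>, so both types impose
  the same cyclic condition.\<close>

lemma inversion_B_iff: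
  assumes "a \<noteq> b" "b \<noteq> c" "a \<noteq> c"
  shows "inversion_B F a b c \<longleftrightarrow> \<not> cyc (F a) (F b) (F c)"
  using assms unfolding inversion_B_def increasing_order_def ex_rotate3_iff cyc_def by auto

definition rows_ok :: "nat \<Rightarrow> (nat \<Rightarrow> nat) \<Rightarrow> (box \<Rightarrow> entry) \<Rightarrow> bool" where
  "rows_ok n \<alpha> F \<longleftrightarrow> (\<forall>r k. 1 \<le> r \<and> r < k \<and> k \<le> n \<longrightarrow>
     row_ok (\<alpha> r) (\<lambda>j. F (r, j)) (\<alpha> k) (\<lambda>j. F (k, j)))"

lemma no_A_inversion_iff:
  "(\<forall>a b c. type_A_triple n \<alpha> a b c \<longrightarrow> \<not> inversion_A F a b c) \<longleftrightarrow>
   (\<forall>r k j. 1 \<le> r \<and> r < k \<and> k \<le> n \<and> \<alpha> k \<le> \<alpha> r \<and> j < \<alpha> k \<longrightarrow>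
      cyc (F (r, j)) (F (r, Suc j)) (F (k, Suc j)))" (is "?l \<longleftrightarrow> ?r")
proof
  assume l: ?l
  show ?r
  proof (intro allI impI)
    fix r k j assume *: "1 \<le> r \<and> r < k \<and> k \<le> n \<and> \<alpha> k \<le> \<alpha> r \<and> j < \<alpha> k"
    then have "type_A_triple n \<alpha> (r, j) (r, Suc j) (k, Suc j)"
      unfolding type_A_triple_def by (intro conjI exI[of _ r] exI[of _ "Suc j"] exI[of _ k])
        (auto simp: aug_diagram_def)
    then show "cyc (F (r, j)) (F (r, Suc j)) (F (k, Suc j))"
      using l * inversion_A_iff[of "(r, j)" "(r, Suc j)" "(k, Suc j)" F] by auto
  qed
next
  assume r: ?r
  show ?l
  proof (intro allI impI)
    fix a b c assume "type_A_triple n \<alpha> a b c"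
    then obtain r j k where *: "j \<ge> 1" "k > r" "\<alpha> r \<ge> \<alpha> k" "a = (r, j - 1)" "b = (r, j)" "c = (k, j)"
      "1 \<le> r" "k \<le> n" "j \<le> \<alpha> k"
      by (auto simp: type_A_triple_def aug_diagram_def)
    then have "cyc (F a) (F b) (F c)" using r[rule_format, of r k "j - 1"] by auto
    then show "\<not> inversion_A F a b c" using * by (subst inversion_A_iff) auto
  qed
qed

lemma no_B_inversion_iff:
  "(\<forall>a b c. type_B_triple n \<alpha> a b c \<longrightarrow> \<not> inversion_B F a b c) \<longleftrightarrow>
   (\<forall>r k j. 1 \<le> r \<and> r < k \<and> k \<le> n \<and> \<alpha> r < \<alpha> k \<and> j \<le> \<alpha> r \<longrightarrow>
      cyc (F (k, j)) (F (k, Suc j)) (F (r, j)))" (is "?l \<longleftrightarrow> ?r")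
proof
  assume l: ?l
  show ?r
  proof (intro allI impI)
    fix r k j assume *: "1 \<le> r \<and> r < k \<and> k \<le> n \<and> \<alpha> r < \<alpha> k \<and> j \<le> \<alpha> r"
    then have "type_B_triple n \<alpha> (k, j) (k, Suc j) (r, j)"
      unfolding type_B_triple_def by (intro conjI exI[of _ k] exI[of _ "Suc j"] exI[of _ r])
        (auto simp: aug_diagram_def)
    then show "cyc (F (k, j)) (F (k, Suc j)) (F (r, j))"
      using l * inversion_B_iff[of "(k, j)" "(k, Suc j)" "(r, j)" F] by auto
  qed
next
  assume r: ?r
  show ?l
  proof (intro allI impI)
    fix a b c assume "type_B_triple n \<alpha> a b c"
    \<comment> \<open>The row carrying \<open>a\<close> and \<open>b\<close> is the lower one in
      type B; it is named \<open>k\<close> so that \<open>r < k\<close> throughout.\<close>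
    then obtain k j r where *: "j \<ge> 1" "r < k" "\<alpha> k > \<alpha> r" "a = (k, j - 1)" "b = (k, j)" "c = (r, j - 1)"
      "1 \<le> r" "k \<le> n" "j - 1 \<le> \<alpha> r"
      by (auto simp: type_B_triple_def aug_diagram_def)
    then have "cyc (F a) (F b) (F c)" using r[rule_format, of r k "j - 1"] by auto
    then show "\<not> inversion_B F a b c" using * by (subst inversion_B_iff) auto
  qed
qed

lemma InvFree_iff: "F \<in> InvFree n \<alpha> \<sigma> \<longleftrightarrow> F \<in> fillings n \<alpha> \<sigma> \<and> rows_ok n \<alpha> F"
proof -
  have "rows_ok n \<alpha> F \<longleftrightarrow>
      (\<forall>r k j. 1 \<le> r \<and> r < k \<and> k \<le> n \<and> \<alpha> k \<le> \<alpha> r \<and> j < \<alpha> k \<longrightarrow>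
        cyc (F (r, j)) (F (r, Suc j)) (F (k, Suc j))) \<and>
      (\<forall>r k j. 1 \<le> r \<and> r < k \<and> k \<le> n \<and> \<alpha> r < \<alpha> k \<and> j \<le> \<alpha> r \<longrightarrow>
        cyc (F (k, j)) (F (k, Suc j)) (F (r, j)))"
    unfolding rows_ok_def row_ok_def by (simp add: not_le) (meson not_le)
  then show ?thesis
    by (simp only: InvFree_def mem_Collect_eq no_A_inversion_iff no_B_inversion_iff)
qed

definition row_filling :: "nat \<Rightarrow> nat \<Rightarrow> (nat \<Rightarrow> entry) \<Rightarrow> bool" where
  "row_filling p s x \<longleftrightarrow> x 0 = BigInf s \<and> (\<forall>j. 1 \<le> j \<and> j \<le> p \<longrightarrow> (\<exists>m\<ge>1. x j = Val m)) \<and>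
     (\<forall>j>p. x j = undefined)"

lemma fillings_iff:
  "F \<in> fillings n \<alpha> \<sigma> \<longleftrightarrow>
     (\<forall>r\<in>{1..n}. row_filling (\<alpha> r) (\<sigma> r) (\<lambda>j. F (r, j))) \<and> (\<forall>r j. r \<notin> {1..n} \<longrightarrow> F (r, j) = undefined)"
proof -
  have "F \<in> extensional (aug_diagram n \<alpha>) \<longleftrightarrow>
      (\<forall>r j. \<not> (1 \<le> r \<and> r \<le> n \<and> j \<le> \<alpha> r) \<longrightarrow> F (r, j) = undefined)"
    by (auto simp: extensional_def aug_diagram_def)
  also have "\<dots> \<longleftrightarrow>
      (\<forall>r\<in>{1..n}. \<forall>j>\<alpha> r. F (r, j) = undefined) \<and> (\<forall>r j. r \<notin> {1..n} \<longrightarrow> F (r, j) = undefined)"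
    by (metis atLeastAtMost_iff not_le)
  finally have "F \<in> extensional (aug_diagram n \<alpha>) \<longleftrightarrow>
      (\<forall>r\<in>{1..n}. \<forall>j>\<alpha> r. F (r, j) = undefined) \<and> (\<forall>r j. r \<notin> {1..n} \<longrightarrow> F (r, j) = undefined)" .
  moreover have "(\<forall>u\<in>diagram n \<alpha>. \<exists>m\<ge>1. F u = Val m) \<longleftrightarrow>
      (\<forall>r\<in>{1..n}. \<forall>j. 1 \<le> j \<and> j \<le> \<alpha> r \<longrightarrow> (\<exists>m\<ge>1. F (r, j) = Val m))"
    by (auto simp: diagram_def)
  ultimately show ?thesis
    unfolding fillings_def row_filling_def by (simp add: ball_conj_distrib) blast
qed

text \<open>Exchanges take place only in columns 1 to \<open>q\<close>, where both rows hold
  positive integers; the labels and the undefined tails stay put.\<close>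

lemma row_filling_swap:
  assumes "swapped_rows q L S L' S'" "q < p" "row_filling p s L" "row_filling q t S"
  shows "row_filling p s L' \<and> row_filling q t S'"
proof -
  have pair: "L' j = L j \<and> S' j = S j \<or> L' j = S j \<and> S' j = L j" for j
    using assms(1) by (auto simp: swapped_rows_def same_pair_def)
  have tail: "L' j = L j" "S' j = S j" if "q < j \<or> j = 0" for j
    using assms(1) that by (auto simp: swapped_rows_def)
  have L: "L 0 = BigInf s" "\<And>j. 1 \<le> j \<Longrightarrow> j \<le> p \<Longrightarrow> \<exists>m\<ge>1. L j = Val m" "\<And>j. p < j \<Longrightarrow> L j = undefined"
    and S: "S 0 = BigInf t" "\<And>j. 1 \<le> j \<Longrightarrow> j \<le> q \<Longrightarrow> \<exists>m\<ge>1. S j = Val m" "\<And>j. q < j \<Longrightarrow> S j = undefined"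
    using assms(3,4) by (auto simp: row_filling_def)
  have "\<exists>m\<ge>1. S' j = Val m" if "1 \<le> j" "j \<le> q" for j
    using pair[of j] L(2)[of j] S(2)[of j] that assms(2) by auto
  moreover have "\<exists>m\<ge>1. L' j = Val m" if "1 \<le> j" "j \<le> p" for j
    using pair[of j] tail(1)[of j] L(2)[of j] S(2)[of j] that by (cases "j \<le> q") auto
  ultimately show ?thesis
    using tail L(1,3) S(1,3) assms(2) by (auto simp: row_filling_def)
qed

lemma row_filling_swap_iff:
  assumes "swapped_rows q L S L' S'" "q < p"
  shows "row_filling p s L \<and> row_filling q t S \<longleftrightarrow> row_filling p s L' \<and> row_filling q t S'"
  using row_filling_swap[OF assms] row_filling_swap[OF swapped_rows_sym[THEN iffD1, OF assms(1)] assms(2)]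
  by blast

section \<open>Column sets and major index by rows\<close>

lemma column_set_rows:
  assumes "j \<ge> 1"
  shows "column_set n \<alpha> F j = (\<Sum>r\<in>{1..n}. if j \<le> \<alpha> r then {#F (r, j)#} else {#})"
proof -
  let ?R = "{r \<in> {1..n}. j \<le> \<alpha> r}"
  have "{u \<in> diagram n \<alpha>. snd u = j} = (\<lambda>r. (r, j)) ` ?R"
    using assms by (auto simp: diagram_def)
  then have "column_set n \<alpha> F j = image_mset F (mset_set ((\<lambda>r. (r, j)) ` ?R))"
    by (simp add: column_set_def)
  also have "mset_set ((\<lambda>r. (r, j)) ` ?R) = image_mset (\<lambda>r. (r, j)) (mset_set ?R)"
    by (rule image_mset_mset_set[symmetric]) (auto simp: inj_on_def)
  also have "image_mset F \<dots> = (\<Sum>r\<in>?R. {#F (r, j)#})"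
    by (simp add: multiset.map_comp comp_def sum_unfold_sum_mset image_mset.compositionality)
  also have "\<dots> = (\<Sum>r\<in>{1..n}. if j \<le> \<alpha> r then {#F (r, j)#} else {#})"
    by (rule sum.inter_filter) simp
  finally show ?thesis .
qed

lemma maj_rows: "maj n \<alpha> F = (\<Sum>r\<in>{1..n}. row_maj (\<alpha> r) (\<lambda>j. F (r, j)))"
proof -
  let ?f = "\<lambda>(r, j). of_bool (F (r, j) < F (r, Suc j)) * (\<alpha> r - j)"
  let ?D = "SIGMA r:{1..n}. {..<\<alpha> r}"
  have "maj n \<alpha> F = (\<Sum>b\<in>diagram n \<alpha>. if F (fst b, snd b - 1) < F b then leg \<alpha> b + 1 else 0)"
    unfolding maj_def by (subst sum.inter_filter[symmetric])
      (auto simp: finite_diagram descents_def intro!: sum.cong)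
  also have "\<dots> = (\<Sum>b\<in>?D. ?f b)"
    by (rule sum.reindex_bij_witness[of _ "\<lambda>(r, j). (r, Suc j)" "\<lambda>(r, j). (r, j - 1)"])
      (auto simp: diagram_def leg_def)
  also have "\<dots> = (\<Sum>r\<in>{1..n}. row_maj (\<alpha> r) (\<lambda>j. F (r, j)))"
    unfolding row_maj_def by (subst sum.Sigma[symmetric]) auto
  finally show ?thesis .
qed

text \<open>The content depends only on the column sets. \<open>T\<close> may be larger than the set
  of columns, so that two shapes can be summed over a common range.\<close>

lemma content_monom_columns:
  assumes "finite T" "snd ` diagram n \<alpha> \<subseteq> T"
  shows "content_monom n \<alpha> F =
    (\<Sum>j\<in>T. \<Sum>v\<in>#column_set n \<alpha> F j. Poly_Mapping.single (the_val v) 1)"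
proof -
  have "content_monom n \<alpha> F =
      (\<Sum>j\<in>T. \<Sum>u\<in>{u \<in> diagram n \<alpha>. snd u = j}. Poly_Mapping.single (the_val (F u)) 1)"
    unfolding content_monom_def by (rule sum.group[symmetric]) (use assms finite_diagram in auto)
  then show ?thesis
    by (simp add: column_set_def sum_unfold_sum_mset image_mset.compositionality comp_def)
qed

section \<open>Equidistribution\<close>

definition equidistributed ::
  "nat \<Rightarrow> (nat \<Rightarrow> nat) \<Rightarrow> (nat \<Rightarrow> nat) \<Rightarrow> (nat \<Rightarrow> nat) \<Rightarrow> (nat \<Rightarrow> nat) \<Rightarrow> bool" where
  "equidistributed n \<alpha> \<sigma> \<beta> \<rho> \<longleftrightarrow>
     (\<exists>\<Phi>. bij_betw \<Phi> (InvFree n \<alpha> \<sigma>) (InvFree n \<beta> \<rho>) \<and>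
        (\<forall>F \<in> InvFree n \<alpha> \<sigma>. (\<forall>j\<ge>1. column_set n \<beta> (\<Phi> F) j = column_set n \<alpha> F j) \<and>
           maj n \<beta> (\<Phi> F) = maj n \<alpha> F))"

lemma equidistributed_sym:
  assumes "equidistributed n \<alpha> \<sigma> \<beta> \<rho>"
  shows "equidistributed n \<beta> \<rho> \<alpha> \<sigma>"
proof -
  from assms obtain \<Phi> where b: "bij_betw \<Phi> (InvFree n \<alpha> \<sigma>) (InvFree n \<beta> \<rho>)"
    and st: "\<And>F. F \<in> InvFree n \<alpha> \<sigma> \<Longrightarrow> (\<forall>j\<ge>1. column_set n \<beta> (\<Phi> F) j = column_set n \<alpha> F j) \<and>
           maj n \<beta> (\<Phi> F) = maj n \<alpha> F"
    by (auto simp: equidistributed_def)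
  let ?\<Psi> = "inv_into (InvFree n \<alpha> \<sigma>) \<Phi>"
  have 1: "bij_betw ?\<Psi> (InvFree n \<beta> \<rho>) (InvFree n \<alpha> \<sigma>)"
    using b by (rule bij_betw_inv_into)
  have 2: "?\<Psi> G \<in> InvFree n \<alpha> \<sigma>" "\<Phi> (?\<Psi> G) = G" if "G \<in> InvFree n \<beta> \<rho>" for G
    using bij_betw_apply[OF 1 that] bij_betw_inv_into_right[OF b that] by auto
  have "(\<forall>j\<ge>1. column_set n \<alpha> (?\<Psi> G) j = column_set n \<beta> G j) \<and> maj n \<alpha> (?\<Psi> G) = maj n \<beta> G"
    if "G \<in> InvFree n \<beta> \<rho>" for G
    using st[OF 2(1)[OF that]] unfolding 2(2)[OF that] by simp
  with 1 show ?thesis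
    unfolding equidistributed_def by blast
qed

lemma equidistributed_trans:
  assumes "equidistributed n \<alpha> \<sigma> \<beta> \<rho>" "equidistributed n \<beta> \<rho> \<gamma> \<nu>"
  shows "equidistributed n \<alpha> \<sigma> \<gamma> \<nu>"
proof -
  from assms(1) obtain \<Phi> where b: "bij_betw \<Phi> (InvFree n \<alpha> \<sigma>) (InvFree n \<beta> \<rho>)"
    and st: "\<And>F. F \<in> InvFree n \<alpha> \<sigma> \<Longrightarrow> (\<forall>j\<ge>1. column_set n \<beta> (\<Phi> F) j = column_set n \<alpha> F j) \<and>
           maj n \<beta> (\<Phi> F) = maj n \<alpha> F"
    by (auto simp: equidistributed_def)
  from assms(2) obtain \<Psi> where b': "bij_betw \<Psi> (InvFree n \<beta> \<rho>) (InvFree n \<gamma> \<nu>)"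
    and st': "\<And>F. F \<in> InvFree n \<beta> \<rho> \<Longrightarrow> (\<forall>j\<ge>1. column_set n \<gamma> (\<Psi> F) j = column_set n \<beta> F j) \<and>
           maj n \<gamma> (\<Psi> F) = maj n \<beta> F"
    by (auto simp: equidistributed_def)
  have "bij_betw (\<Psi> \<circ> \<Phi>) (InvFree n \<alpha> \<sigma>) (InvFree n \<gamma> \<nu>)"
    using b b' by (rule bij_betw_trans)
  moreover have "(\<forall>j\<ge>1. column_set n \<gamma> ((\<Psi> \<circ> \<Phi>) F) j = column_set n \<alpha> F j) \<and>
      maj n \<gamma> ((\<Psi> \<circ> \<Phi>) F) = maj n \<alpha> F" if "F \<in> InvFree n \<alpha> \<sigma>" for F
    using st[OF that] st'[OF bij_betw_apply[OF b that]] by auto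
  ultimately show ?thesis unfolding equidistributed_def by blast
qed

lemma equidistributed_Htilde:
  assumes "equidistributed n \<alpha> \<sigma> \<beta> \<rho>"
  shows "Htilde n \<sigma> \<alpha> = Htilde n \<rho> \<beta>"
proof
  fix m
  from assms obtain \<Phi> where b: "bij_betw \<Phi> (InvFree n \<alpha> \<sigma>) (InvFree n \<beta> \<rho>)"
    and col: "\<And>F j. F \<in> InvFree n \<alpha> \<sigma> \<Longrightarrow> j \<ge> 1 \<Longrightarrow> column_set n \<beta> (\<Phi> F) j = column_set n \<alpha> F j"
    and mj: "\<And>F. F \<in> InvFree n \<alpha> \<sigma> \<Longrightarrow> maj n \<beta> (\<Phi> F) = maj n \<alpha> F"
    by (auto simp: equidistributed_def)
  let ?T = "snd ` diagram n \<alpha> \<union> snd ` diagram n \<beta>"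
  have content: "content_monom n \<beta> (\<Phi> F) = content_monom n \<alpha> F" if "F \<in> InvFree n \<alpha> \<sigma>" for F
  proof -
    have T: "finite ?T" using finite_diagram by auto
    have "1 \<le> j" if "j \<in> ?T" for j using that by (auto simp: diagram_def)
    then show ?thesis
      using col[OF that] unfolding content_monom_columns[OF T Un_upper1] content_monom_columns[OF T Un_upper2]
      by (intro sum.cong) auto
  qed
  \<comment> \<open>Since content is preserved, the bijection restricts to the fillings that
    contribute to one coefficient.\<close>
  have "bij_betw \<Phi> {F \<in> InvFree n \<alpha> \<sigma>. content_monom n \<alpha> F = m}
      {F \<in> InvFree n \<beta> \<rho>. content_monom n \<beta> F = m}"
    using b content unfolding bij_betw_def inj_on_def
    by (auto, metis (mono_tags, lifting) image_iff mem_Collect_eq)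
  from sum.reindex_bij_betw[OF this, of "\<lambda>F. monom (1 :: int) (maj n \<beta> F)"]
  show "Htilde n \<sigma> \<alpha> m = Htilde n \<rho> \<beta> m"
    unfolding Htilde_def by (simp add: mj)
qed

section \<open>Swapping adjacent rows of a filling\<close>

text \<open>Reads a bijection off a relation in which partners are unique in both
  directions.\<close>

lemma bij_betw_of_relation:
  assumes "\<And>a. a \<in> A \<Longrightarrow> \<exists>!b. b \<in> B \<and> R a b" "\<And>b. b \<in> B \<Longrightarrow> \<exists>!a. a \<in> A \<and> R a b"
  shows "\<exists>\<Phi>. bij_betw \<Phi> A B \<and> (\<forall>a\<in>A. R a (\<Phi> a))"
proof -
  define \<Phi> where "\<Phi> a = (THE b. b \<in> B \<and> R a b)" for a
  have \<Phi>: "\<Phi> a \<in> B" "R a (\<Phi> a)" if "a \<in> A" for a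
    using theI'[OF assms(1)[OF that]] by (auto simp: \<Phi>_def)
  have "inj_on \<Phi> A"
    using \<Phi> assms(2) unfolding inj_on_def by metis
  moreover have "b \<in> \<Phi> ` A" if b: "b \<in> B" for b
  proof -
    from assms(2)[OF b] obtain a where "a \<in> A" "R a b" by blast
    then show ?thesis using \<Phi>[of a] assms(1)[of a] b by blast
  qed
  ultimately have "bij_betw \<Phi> A B" using \<Phi>(1) by (auto simp: bij_betw_def)
  then show ?thesis using \<Phi>(2) by blast
qed

text \<open>The row indices are crossed: the longer row is meant to be row \<open>i\<close> of
  \<open>F\<close> and row \<open>Suc i\<close> of \<open>G\<close>.\<close>

definition swapped_fillings :: "nat \<Rightarrow> nat \<Rightarrow> (box \<Rightarrow> entry) \<Rightarrow> (box \<Rightarrow> entry) \<Rightarrow> bool" where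
  "swapped_fillings i q F G \<longleftrightarrow>
     (\<forall>r j. r \<noteq> i \<and> r \<noteq> Suc i \<longrightarrow> G (r, j) = F (r, j)) \<and>
     swapped_rows q (\<lambda>j. F (i, j)) (\<lambda>j. F (Suc i, j)) (\<lambda>j. G (Suc i, j)) (\<lambda>j. G (i, j))"

text \<open>Sorts the pairs of rows by their position relative to the two exchanged rows; the mixed
  pairs are grouped as the third-row lemmas require.\<close>

lemma all_pairs_split:
  fixes n i :: nat
  assumes "1 \<le> i" "Suc i \<le> n"
  shows "(\<forall>r k. 1 \<le> r \<and> r < k \<and> k \<le> n \<longrightarrow> P r k) \<longleftrightarrow>
    P i (Suc i) \<and> (\<forall>k. Suc i < k \<and> k \<le> n \<longrightarrow> P i k \<and> P (Suc i) k) \<and>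
    (\<forall>r. 1 \<le> r \<and> r < i \<longrightarrow> P r i \<and> P r (Suc i)) \<and>
    (\<forall>r k. 1 \<le> r \<and> r < k \<and> k \<le> n \<and> r \<notin> {i, Suc i} \<and> k \<notin> {i, Suc i} \<longrightarrow> P r k)"
    (is "?l \<longleftrightarrow> ?r")
proof
  assume ?l
  then show ?r using assms by auto
next
  assume r: ?r
  show ?l
  proof (intro allI impI)
    fix r k assume *: "1 \<le> r \<and> r < k \<and> k \<le> n"
    consider "r = i" "k = Suc i" | "r \<in> {i, Suc i}" "Suc i < k" | "k \<in> {i, Suc i}" "r < i"
      | "r \<notin> {i, Suc i}" "k \<notin> {i, Suc i}"
      using * by fastforce
    then show "P r k" using r * by cases auto
  qed
qed

lemma sum_split_adjacent:
  fixes f :: "nat \<Rightarrow> 'b::comm_monoid_add"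
  assumes "1 \<le> i" "Suc i \<le> n"
  shows "sum f {1..n} = f i + f (Suc i) + sum f ({1..n} - {i, Suc i})"
proof -
  have "sum f {1..n} = sum f {i, Suc i} + sum f ({1..n} - {i, Suc i})"
    by (rule sum.subset_diff[THEN trans, OF _ _ add.commute]) (use assms in auto)
  then show ?thesis by simp
qed

locale adjacent_swap =
  fixes n i :: nat and \<alpha> \<sigma> \<beta> \<rho> :: "nat \<Rightarrow> nat"
  assumes i: "1 \<le> i" "Suc i \<le> n"
    and shorter: "\<alpha> (Suc i) < \<alpha> i" and label: "\<sigma> (Suc i) < \<sigma> i"
    and beta: "\<beta> = \<alpha> \<circ> Transposition.transpose i (Suc i)"
    and rho: "\<rho> = \<sigma> \<circ> Transposition.transpose i (Suc i)"
begin

lemma beta_simps [simp]: "\<beta> i = \<alpha> (Suc i)" "\<beta> (Suc i) = \<alpha> i" "r \<noteq> i \<Longrightarrow> r \<noteq> Suc i \<Longrightarrow> \<beta> r = \<alpha> r"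
  by (auto simp: beta)

lemma rho_simps [simp]: "\<rho> i = \<sigma> (Suc i)" "\<rho> (Suc i) = \<sigma> i" "r \<noteq> i \<Longrightarrow> r \<noteq> Suc i \<Longrightarrow> \<rho> r = \<sigma> r"
  by (auto simp: rho)

abbreviation "swapped \<equiv> swapped_fillings i (\<alpha> (Suc i))"
abbreviation "aboveF F \<equiv> long_above (\<alpha> (Suc i)) (\<lambda>j. F (i, j)) (\<lambda>j. F (Suc i, j))"
abbreviation "belowF G \<equiv> long_below (\<alpha> (Suc i)) (\<lambda>j. G (Suc i, j)) (\<lambda>j. G (i, j))"

lemma swapped_other: "swapped F G \<Longrightarrow> r \<noteq> i \<Longrightarrow> r \<noteq> Suc i \<Longrightarrow> G (r, j) = F (r, j)"
  by (auto simp: swapped_fillings_def)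

lemma swapped_rowsD: "swapped F G \<Longrightarrow>
    swapped_rows (\<alpha> (Suc i)) (\<lambda>j. F (i, j)) (\<lambda>j. F (Suc i, j)) (\<lambda>j. G (Suc i, j)) (\<lambda>j. G (i, j))"
  by (auto simp: swapped_fillings_def)

lemma fillings_swap:
  assumes "swapped F G"
  shows "F \<in> fillings n \<alpha> \<sigma> \<longleftrightarrow> G \<in> fillings n \<beta> \<rho>"
proof -
  have split: "(\<forall>r\<in>{1..n}. P r) \<longleftrightarrow> (P i \<and> P (Suc i)) \<and> (\<forall>r\<in>{1..n} - {i, Suc i}. P r)" for P
    using i by auto
  have "(\<forall>r\<in>{1..n} - {i, Suc i}. row_filling (\<alpha> r) (\<sigma> r) (\<lambda>j. F (r, j))) \<longleftrightarrow>
      (\<forall>r\<in>{1..n} - {i, Suc i}. row_filling (\<beta> r) (\<rho> r) (\<lambda>j. G (r, j)))"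
    using swapped_other[OF assms] by simp
  moreover have "(\<forall>r j. r \<notin> {1..n} \<longrightarrow> F (r, j) = undefined) \<longleftrightarrow> (\<forall>r j. r \<notin> {1..n} \<longrightarrow> G (r, j) = undefined)"
    using swapped_other[OF assms] i by (metis atLeastAtMost_iff le_SucI Suc_leD)
  ultimately show ?thesis
    unfolding fillings_iff split
    using row_filling_swap_iff[OF swapped_rowsD[OF assms] shorter, of "\<sigma> i" "\<sigma> (Suc i)"] by auto
qed

lemma rows_ok_aboveF: "rows_ok n \<alpha> F \<Longrightarrow> aboveF F"
  using i shorter by (auto simp: rows_ok_def row_ok_def long_above_def)

lemma rows_ok_belowF: "rows_ok n \<beta> G \<Longrightarrow> belowF G"
  using i shorter unfolding rows_ok_def
  by (auto simp: row_ok_def long_below_def dest!: spec[of _ i] spec[of _ "Suc i"])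

lemma row_swapI:
  assumes "swapped F G" "aboveF F" "belowF G"
  shows "row_swap (\<alpha> i) (\<alpha> (Suc i)) (\<lambda>j. F (i, j)) (\<lambda>j. F (Suc i, j)) (\<lambda>j. G (Suc i, j)) (\<lambda>j. G (i, j))"
  using assms shorter swapped_rowsD by unfold_locales auto

text \<open>The condition between the two exchanged rows is contained in \<open>aboveF\<close> and
  \<open>belowF\<close>; pairs with one exchanged row are covered by the third-row lemmas.\<close>

lemma rows_ok_swap:
  assumes "swapped F G" "aboveF F" "belowF G"
  shows "rows_ok n \<alpha> F \<longleftrightarrow> rows_ok n \<beta> G"
proof -
  interpret S: row_swap "\<alpha> i" "\<alpha> (Suc i)" "\<lambda>j. F (i, j)" "\<lambda>j. F (Suc i, j)" "\<lambda>j. G (Suc i, j)" "\<lambda>j. G (i, j)"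
    by (rule row_swapI) fact+
  have 1: "row_ok (\<alpha> i) (\<lambda>j. F (i, j)) (\<alpha> (Suc i)) (\<lambda>j. F (Suc i, j))"
    "row_ok (\<beta> i) (\<lambda>j. G (i, j)) (\<beta> (Suc i)) (\<lambda>j. G (Suc i, j))"
    using assms(2,3) shorter by (auto simp: row_ok_def long_above_def long_below_def)
  have 2: "row_ok (\<alpha> i) (\<lambda>j. F (i, j)) (\<alpha> k) (\<lambda>j. F (k, j)) \<and>
      row_ok (\<alpha> (Suc i)) (\<lambda>j. F (Suc i, j)) (\<alpha> k) (\<lambda>j. F (k, j)) \<longleftrightarrow>
    row_ok (\<beta> i) (\<lambda>j. G (i, j)) (\<beta> k) (\<lambda>j. G (k, j)) \<and>
      row_ok (\<beta> (Suc i)) (\<lambda>j. G (Suc i, j)) (\<beta> k) (\<lambda>j. G (k, j))" if "Suc i < k \<and> k \<le> n" for k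
    using that S.third_row_below[of "\<alpha> k" "\<lambda>j. F (k, j)"] by (auto simp: swapped_other[OF assms(1)])
  have 3: "row_ok (\<alpha> r) (\<lambda>j. F (r, j)) (\<alpha> i) (\<lambda>j. F (i, j)) \<and>
      row_ok (\<alpha> r) (\<lambda>j. F (r, j)) (\<alpha> (Suc i)) (\<lambda>j. F (Suc i, j)) \<longleftrightarrow>
    row_ok (\<beta> r) (\<lambda>j. G (r, j)) (\<beta> i) (\<lambda>j. G (i, j)) \<and>
      row_ok (\<beta> r) (\<lambda>j. G (r, j)) (\<beta> (Suc i)) (\<lambda>j. G (Suc i, j))" if "1 \<le> r \<and> r < i" for r
    using that S.third_row_above[of "\<alpha> r" "\<lambda>j. F (r, j)"] by (auto simp: swapped_other[OF assms(1)])
  have 4: "row_ok (\<alpha> r) (\<lambda>j. F (r, j)) (\<alpha> k) (\<lambda>j. F (k, j)) \<longleftrightarrow>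
      row_ok (\<beta> r) (\<lambda>j. G (r, j)) (\<beta> k) (\<lambda>j. G (k, j))"
    if "1 \<le> r \<and> r < k \<and> k \<le> n \<and> r \<notin> {i, Suc i} \<and> k \<notin> {i, Suc i}" for r k
    using that by (auto simp: swapped_other[OF assms(1)])
  show ?thesis
    unfolding rows_ok_def all_pairs_split[OF i] using 1 2 3 4 by (simp only: simp_thms cong: imp_cong)
qed

lemma swapped_statistics:
  assumes "swapped F G" "aboveF F" "belowF G"
  shows "maj n \<beta> G = maj n \<alpha> F" "j \<ge> 1 \<Longrightarrow> column_set n \<beta> G j = column_set n \<alpha> F j"
proof -
  interpret S: row_swap "\<alpha> i" "\<alpha> (Suc i)" "\<lambda>j. F (i, j)" "\<lambda>j. F (Suc i, j)" "\<lambda>j. G (Suc i, j)" "\<lambda>j. G (i, j)"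
    by (rule row_swapI) fact+
  have "(\<Sum>r\<in>{1..n} - {i, Suc i}. row_maj (\<beta> r) (\<lambda>j. G (r, j))) =
      (\<Sum>r\<in>{1..n} - {i, Suc i}. row_maj (\<alpha> r) (\<lambda>j. F (r, j)))"
    by (rule sum.cong) (auto simp: swapped_other[OF assms(1)])
  then show "maj n \<beta> G = maj n \<alpha> F"
    using S.row_maj_swap unfolding maj_rows sum_split_adjacent[OF i] by simp
  assume j: "j \<ge> 1"
  have "(\<Sum>r\<in>{1..n} - {i, Suc i}. if j \<le> \<beta> r then {#G (r, j)#} else {#}) =
      (\<Sum>r\<in>{1..n} - {i, Suc i}. if j \<le> \<alpha> r then {#F (r, j)#} else {#})"
    by (rule sum.cong) (auto simp: swapped_other[OF assms(1)])
  then show "column_set n \<beta> G j = column_set n \<alpha> F j"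
    using S.pair_cases[of j] S.tail[of j] shorter
    unfolding column_set_rows[OF j] sum_split_adjacent[OF i] by auto
qed

text \<open>Provides the assumptions of \<open>exists_long_below\<close>: basement symbols exceed
  ordinary entries, and the longer row has the larger label.\<close>

lemma first_entries:
  assumes "F \<in> fillings n \<alpha> \<sigma>"
  shows "F (Suc i, 0) \<le> F (i, 0)" "F (i, 1) \<le> F (Suc i, 0)" "0 < \<alpha> (Suc i) \<Longrightarrow> F (Suc i, 1) \<le> F (Suc i, 0)"
proof -
  have L: "row_filling (\<alpha> i) (\<sigma> i) (\<lambda>j. F (i, j))"
    and S: "row_filling (\<alpha> (Suc i)) (\<sigma> (Suc i)) (\<lambda>j. F (Suc i, j))"
    using assms i by (auto simp: fillings_iff)
  show "F (Suc i, 0) \<le> F (i, 0)" using L S label by (auto simp: row_filling_def)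
  have "\<exists>m. F (i, 1) = Val m" using L shorter unfolding row_filling_def
    by (metis Suc_leI less_nat_zero_code neq0_conv One_nat_def order_refl)
  then show "F (i, 1) \<le> F (Suc i, 0)" using S by (auto simp: row_filling_def)
  assume "0 < \<alpha> (Suc i)"
  then have "\<exists>m. F (Suc i, 1) = Val m" using S unfolding row_filling_def
    by (metis Suc_leI One_nat_def order_refl)
  then show "F (Suc i, 1) \<le> F (Suc i, 0)" using S by (auto simp: row_filling_def)
qed

lemma swapped_eqI:
  fixes F G :: "box \<Rightarrow> entry"
  assumes "\<And>r j. r \<noteq> i \<Longrightarrow> r \<noteq> Suc i \<Longrightarrow> F (r, j) = G (r, j)"
    and "(\<lambda>j. F (i, j)) = (\<lambda>j. G (i, j))" "(\<lambda>j. F (Suc i, j)) = (\<lambda>j. G (Suc i, j))"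
  shows "F = G"
proof
  fix u :: box
  show "F u = G u"
    using assms(1)[of "fst u" "snd u"] assms(2,3)[THEN fun_cong, of "snd u"]
    by (cases u; cases "fst u = i"; cases "fst u = Suc i") auto
qed

section \<open>Unique partners of inversion-free fillings\<close>

lemma swap_exists_unique:
  assumes F: "F \<in> InvFree n \<alpha> \<sigma>"
  shows "\<exists>!G. G \<in> InvFree n \<beta> \<rho> \<and> swapped F G"
proof (rule ex_ex1I)
  from F have F': "F \<in> fillings n \<alpha> \<sigma>" "rows_ok n \<alpha> F" by (auto simp: InvFree_iff)
  have "\<exists>L' S'. swapped_rows (\<alpha> (Suc i)) (\<lambda>j. F (i, j)) (\<lambda>j. F (Suc i, j)) L' S' \<and>
      long_below (\<alpha> (Suc i)) L' S'"
    by (rule exists_long_below) (fact first_entries[OF F'(1)])+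
  then obtain L' S' where *: "swapped_rows (\<alpha> (Suc i)) (\<lambda>j. F (i, j)) (\<lambda>j. F (Suc i, j)) L' S'"
    "long_below (\<alpha> (Suc i)) L' S'"
    by blast
  define G where "G = (\<lambda>(r, j). if r = i then S' j else if r = Suc i then L' j else F (r, j))"
  have "swapped F G" "belowF G"
    using * by (auto simp: swapped_fillings_def G_def)
  then have "G \<in> InvFree n \<beta> \<rho>"
    using F' fillings_swap[of F G] rows_ok_swap[of F G] rows_ok_aboveF[of F] by (auto simp: InvFree_iff)
  then show "\<exists>G. G \<in> InvFree n \<beta> \<rho> \<and> swapped F G" using \<open>swapped F G\<close> by blast
next
  fix G H assume G: "G \<in> InvFree n \<beta> \<rho> \<and> swapped F G" and H: "H \<in> InvFree n \<beta> \<rho> \<and> swapped F H"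
  then have "belowF G" "belowF H" using rows_ok_belowF by (auto simp: InvFree_iff)
  then have "(\<lambda>j. G (Suc i, j)) = (\<lambda>j. H (Suc i, j)) \<and> (\<lambda>j. G (i, j)) = (\<lambda>j. H (i, j))"
    using long_below_unique swapped_rowsD G H by blast
  then show "G = H"
    using swapped_other[of F G] swapped_other[of F H] G H by (intro swapped_eqI) auto
qed

lemma unswap_exists_unique:
  assumes G: "G \<in> InvFree n \<beta> \<rho>"
  shows "\<exists>!F. F \<in> InvFree n \<alpha> \<sigma> \<and> swapped F G"
proof (rule ex_ex1I)
  from G have G': "G \<in> fillings n \<beta> \<rho>" "rows_ok n \<beta> G" by (auto simp: InvFree_iff)
  obtain L S where *: "swapped_rows (\<alpha> (Suc i)) (\<lambda>j. G (Suc i, j)) (\<lambda>j. G (i, j)) L S"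
    "long_above (\<alpha> (Suc i)) L S"
    using exists_long_above by blast
  define F where "F = (\<lambda>(r, j). if r = i then L j else if r = Suc i then S j else G (r, j))"
  have "swapped F G" "aboveF F"
    using * by (auto simp: swapped_fillings_def F_def swapped_rows_sym[of _ L S])
  then have "F \<in> InvFree n \<alpha> \<sigma>"
    using G' fillings_swap[of F G] rows_ok_swap[of F G] rows_ok_belowF[of G] by (auto simp: InvFree_iff)
  then show "\<exists>F. F \<in> InvFree n \<alpha> \<sigma> \<and> swapped F G" using \<open>swapped F G\<close> by blast
next
  fix F H assume F: "F \<in> InvFree n \<alpha> \<sigma> \<and> swapped F G" and H: "H \<in> InvFree n \<alpha> \<sigma> \<and> swapped H G"
  then have "aboveF F" "aboveF H" using rows_ok_aboveF by (auto simp: InvFree_iff)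
  then have "(\<lambda>j. F (i, j)) = (\<lambda>j. H (i, j)) \<and> (\<lambda>j. F (Suc i, j)) = (\<lambda>j. H (Suc i, j))"
    using long_above_unique swapped_rows_sym[THEN iffD1, OF swapped_rowsD] F H by blast
  then show "F = H"
    using swapped_other[of F G] swapped_other[of H G] F H by (intro swapped_eqI) auto
qed

lemma equidistributed_swap: "equidistributed n \<alpha> \<sigma> \<beta> \<rho>"
proof -
  obtain \<Phi> where b: "bij_betw \<Phi> (InvFree n \<alpha> \<sigma>) (InvFree n \<beta> \<rho>)"
    and s: "\<And>F. F \<in> InvFree n \<alpha> \<sigma> \<Longrightarrow> swapped F (\<Phi> F)"
    using bij_betw_of_relation[of "InvFree n \<alpha> \<sigma>" "InvFree n \<beta> \<rho>" swapped]
      swap_exists_unique unswap_exists_unique by blast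
  have "(\<forall>j\<ge>1. column_set n \<beta> (\<Phi> F) j = column_set n \<alpha> F j) \<and> maj n \<beta> (\<Phi> F) = maj n \<alpha> F"
    if F: "F \<in> InvFree n \<alpha> \<sigma>" for F
  proof -
    have "aboveF F" "belowF (\<Phi> F)"
      using F bij_betw_apply[OF b F] rows_ok_aboveF rows_ok_belowF by (auto simp: InvFree_iff)
    then show ?thesis using swapped_statistics[OF s[OF F]] by blast
  qed
  with b show ?thesis unfolding equidistributed_def by blast
qed

end

section \<open>Permuting the rows\<close>

text \<open>The part of the relation between \<lambda> and \<open>w0\<close> that survives permuting
  rows with their labels. Rows of equal length may carry their labels in any order.\<close>

definition compatible :: "nat \<Rightarrow> (nat \<Rightarrow> nat) \<Rightarrow> (nat \<Rightarrow> nat) \<Rightarrow> bool" where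
  "compatible n \<alpha> \<sigma> \<longleftrightarrow> (\<forall>r\<in>{1..n}. \<forall>k\<in>{1..n}. \<alpha> r < \<alpha> k \<longrightarrow> \<sigma> r < \<sigma> k)"

section \<open>Changing the basement labels\<close>

definition set_basement :: "nat \<Rightarrow> (nat \<Rightarrow> nat) \<Rightarrow> (box \<Rightarrow> entry) \<Rightarrow> box \<Rightarrow> entry" where
  "set_basement n \<rho> F = (\<lambda>(r, j). if j = 0 \<and> r \<in> {1..n} then BigInf (\<rho> r) else F (r, j))"

lemma set_basement_fillings:
  "F \<in> fillings n \<alpha> \<sigma> \<Longrightarrow> set_basement n \<rho> F \<in> fillings n \<alpha> \<rho>"
  by (auto simp: fillings_iff row_filling_def set_basement_def)

text \<open>Labels enter only the conditions at column 0. In type A the basement symbol exceeds two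
  ordinary entries, whatever its index; in type B the longer row must have the label that is not
  smaller, which compatibility grants.\<close>

lemma set_basement_InvFree:
  assumes F: "F \<in> InvFree n \<alpha> \<sigma>" and c: "compatible n \<alpha> \<rho>"
  shows "set_basement n \<rho> F \<in> InvFree n \<alpha> \<rho>"
proof -
  let ?G = "set_basement n \<rho> F"
  have fill: "F \<in> fillings n \<alpha> \<sigma>" and ok: "rows_ok n \<alpha> F" using F by (auto simp: InvFree_iff)
  have bas: "F (r, 0) = BigInf (\<sigma> r)" "?G (r, 0) = BigInf (\<rho> r)" if "1 \<le> r" "r \<le> n" for r
    using fill that by (auto simp: fillings_iff row_filling_def set_basement_def)
  have one: "\<exists>m. F (r, Suc 0) = Val m" if "1 \<le> r" "r \<le> n" "0 < \<alpha> r" for r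
  proof -
    have "row_filling (\<alpha> r) (\<sigma> r) (\<lambda>j. F (r, j))" using fill that by (simp add: fillings_iff)
    then show ?thesis using that(3) by (auto simp: row_filling_def)
  qed
  have [simp]: "?G (r, Suc j) = F (r, Suc j)" for r j
    by (simp add: set_basement_def)
  have "row_ok (\<alpha> r) (\<lambda>j. ?G (r, j)) (\<alpha> k) (\<lambda>j. ?G (k, j))" if rk: "1 \<le> r" "r < k" "k \<le> n" for r k
  proof (cases "\<alpha> k \<le> \<alpha> r")
    case True
    have *: "cyc (F (r, j)) (F (r, Suc j)) (F (k, Suc j))" if "j < \<alpha> k" for j
      using ok rk True that unfolding rows_ok_def row_ok_def by auto
    have "cyc (?G (r, j)) (?G (r, Suc j)) (?G (k, Suc j))" if j: "j < \<alpha> k" for j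
    proof (cases j)
      case 0
      have "\<exists>m. F (r, Suc 0) = Val m" "\<exists>m. F (k, Suc 0) = Val m"
        using one[of r] one[of k] rk True j by auto
      then show ?thesis using *[OF j] bas[of r] rk 0 by (auto simp: cyc_def)
    next
      case (Suc i)
      then show ?thesis using *[OF j] by simp
    qed
    then show ?thesis using True by (simp add: row_ok_def)
  next
    case False
    have *: "cyc (F (k, j)) (F (k, Suc j)) (F (r, j))" if "j \<le> \<alpha> r" for j
      using ok rk False that unfolding rows_ok_def row_ok_def by auto
    have "cyc (?G (k, j)) (?G (k, Suc j)) (?G (r, j))" if j: "j \<le> \<alpha> r" for j
    proof (cases j)
      case 0
      have "\<exists>m. F (k, Suc 0) = Val m" using one[of k] rk False by auto
      moreover have "\<rho> r < \<rho> k" using c rk False by (auto simp: compatible_def)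
      ultimately show ?thesis using bas[of r] bas[of k] rk 0 by (auto simp: cyc_def)
    next
      case (Suc i)
      then show ?thesis using *[OF j] by simp
    qed
    then show ?thesis using False by (simp add: row_ok_def)
  qed
  then show ?thesis
    using set_basement_fillings[OF fill] by (auto simp: InvFree_iff rows_ok_def)
qed

lemma set_basement_cancel:
  assumes "F \<in> fillings n \<alpha> \<sigma>"
  shows "set_basement n \<sigma> (set_basement n \<rho> F) = F"
  using assms by (auto simp: set_basement_def fillings_iff row_filling_def fun_eq_iff)

lemma equidistributed_basement:
  assumes c: "compatible n \<alpha> \<sigma>" "compatible n \<alpha> \<rho>"
  shows "equidistributed n \<alpha> \<sigma> \<alpha> \<rho>"
proof -
  have b: "bij_betw (set_basement n \<rho>) (InvFree n \<alpha> \<sigma>) (InvFree n \<alpha> \<rho>)"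
  proof (rule bij_betwI[where g = "set_basement n \<sigma>"])
    show "set_basement n \<sigma> (set_basement n \<rho> F) = F" if "F \<in> InvFree n \<alpha> \<sigma>" for F
      using that set_basement_cancel by (auto simp: InvFree_iff)
    show "set_basement n \<rho> (set_basement n \<sigma> F) = F" if "F \<in> InvFree n \<alpha> \<rho>" for F
      using that set_basement_cancel by (auto simp: InvFree_iff)
  qed (use c set_basement_InvFree in blast)+
  have "column_set n \<alpha> (set_basement n \<rho> F) j = column_set n \<alpha> F j" if "j \<ge> 1" for F j
    unfolding column_set_rows[OF that] using that by (auto simp: set_basement_def intro!: sum.cong)
  moreover have "maj n \<alpha> (set_basement n \<rho> F) = maj n \<alpha> F" if "F \<in> InvFree n \<alpha> \<sigma>" for F
    unfolding maj_rows
  proof (rule sum.cong[OF refl])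
    fix r assume r: "r \<in> {1..n}"
    let ?G = "set_basement n \<rho> F"
    have fill: "row_filling (\<alpha> r) (\<sigma> r) (\<lambda>j. F (r, j))"
      using that r by (auto simp: InvFree_iff fillings_iff)
    \<comment> \<open>A basement symbol exceeds its right neighbour under either labelling, so
      column 1 never contains a descent.\<close>
    have "?G (r, j) < ?G (r, Suc j) \<longleftrightarrow> F (r, j) < F (r, Suc j)" if "j < \<alpha> r" for j
    proof (cases j)
      case 0
      have "\<exists>m. F (r, Suc 0) = Val m" "F (r, 0) = BigInf (\<sigma> r)"
        using fill that by (auto simp: row_filling_def)
      then show ?thesis using 0 r by (auto simp: set_basement_def)
    qed (simp add: set_basement_def)
    then show "row_maj (\<alpha> r) (\<lambda>j. ?G (r, j)) = row_maj (\<alpha> r) (\<lambda>j. F (r, j))"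
      unfolding row_maj_def by (intro sum.cong) auto
  qed
  ultimately show ?thesis
    using b unfolding equidistributed_def by blast
qed

section \<open>From adjacent transpositions to all permutations\<close>

lemma compatible_permute:
  assumes "compatible n \<alpha> \<sigma>" "\<pi> permutes {1..n}"
  shows "compatible n (\<alpha> \<circ> \<pi>) (\<sigma> \<circ> \<pi>)"
  using assms permutes_in_image[OF assms(2)] by (simp add: compatible_def)

lemma equidistributed_adjacent:
  assumes c: "compatible n \<alpha> \<sigma>" and i: "1 \<le> i" "Suc i \<le> n"
  shows "equidistributed n \<alpha> \<sigma> (\<alpha> \<circ> Transposition.transpose i (Suc i)) (\<sigma> \<circ> Transposition.transpose i (Suc i))"
    (is "equidistributed _ _ _ (_ \<circ> ?t) _")
proof -
  have c': "compatible n (\<alpha> \<circ> ?t) (\<sigma> \<circ> ?t)"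
    by (rule compatible_permute[OF c]) (use i in \<open>auto intro: permutes_swap_id\<close>)
  consider "\<alpha> (Suc i) < \<alpha> i" | "\<alpha> i < \<alpha> (Suc i)" | "\<alpha> i = \<alpha> (Suc i)" by linarith
  then show ?thesis
  proof cases
    case 1
    then have "\<sigma> (Suc i) < \<sigma> i" using c i by (auto simp: compatible_def)
    then interpret adjacent_swap n i \<alpha> \<sigma> "\<alpha> \<circ> ?t" "\<sigma> \<circ> ?t"
      using 1 i by unfold_locales auto
    show ?thesis by (rule equidistributed_swap)
  next
    case 2
    then have "\<sigma> i < \<sigma> (Suc i)" using c i by (auto simp: compatible_def)
    \<comment> \<open>The roles are reversed: the transposed shape has its longer row on top, and
      transposing again returns \<alpha> and \<sigma>.\<close>
    then interpret adjacent_swap n i "\<alpha> \<circ> ?t" "\<sigma> \<circ> ?t" \<alpha> \<sigma>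
      using 2 i by unfold_locales (auto simp: comp_assoc)
    show ?thesis by (rule equidistributed_sym[OF equidistributed_swap])
  next
    case 3
    \<comment> \<open>The shape is unchanged, and only the labels of the two rows are
      exchanged.\<close>
    then have "\<alpha> \<circ> ?t = \<alpha>" by (auto simp: fun_eq_iff Transposition.transpose_def)
    then show ?thesis using equidistributed_basement[OF c] c' by simp
  qed
qed

text \<open>Induction on \<open>b\<close>: conjugating the transposition of \<open>a\<close> and
  \<open>b\<close> by the adjacent transposition of \<open>b\<close> and \<open>Suc b\<close> gives
  that of \<open>a\<close> and \<open>Suc b\<close>.\<close>

lemma equidistributed_transpose:
  assumes "compatible n \<alpha> \<sigma>" "1 \<le> a" "a < b" "b \<le> n"
  shows "equidistributed n \<alpha> \<sigma> (\<alpha> \<circ> Transposition.transpose a b) (\<sigma> \<circ> Transposition.transpose a b)"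
  using assms
proof (induction b arbitrary: \<alpha> \<sigma>)
  case 0
  then show ?case by simp
next
  case (Suc b)
  show ?case
  proof (cases "a = b")
    case True
    then show ?thesis using equidistributed_adjacent[of n \<alpha> \<sigma> b] Suc.prems by (simp del: comp_apply)
  next
    case False
    let ?u = "Transposition.transpose b (Suc b)" and ?v = "Transposition.transpose a b"
    have u: "?u permutes {1..n}" and v: "?v permutes {1..n}"
      using Suc.prems by (auto intro!: permutes_swap_id)
    have eq: "Transposition.transpose a (Suc b) = ?u \<circ> ?v \<circ> ?u"
      using False Suc.prems by (auto simp: fun_eq_iff Transposition.transpose_def)
    have c1: "compatible n (\<alpha> \<circ> ?u) (\<sigma> \<circ> ?u)"
      by (rule compatible_permute) fact+
    have c2: "compatible n (\<alpha> \<circ> ?u \<circ> ?v) (\<sigma> \<circ> ?u \<circ> ?v)"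
      by (rule compatible_permute) fact+
    have "equidistributed n \<alpha> \<sigma> (\<alpha> \<circ> ?u) (\<sigma> \<circ> ?u)"
      using equidistributed_adjacent Suc.prems by auto
    also have "equidistributed n (\<alpha> \<circ> ?u) (\<sigma> \<circ> ?u) (\<alpha> \<circ> ?u \<circ> ?v) (\<sigma> \<circ> ?u \<circ> ?v)"
      by (rule Suc.IH[OF c1]) (use Suc.prems False in auto)
    finally (equidistributed_trans) have "equidistributed n \<alpha> \<sigma> (\<alpha> \<circ> ?u \<circ> ?v) (\<sigma> \<circ> ?u \<circ> ?v)" .
    also have "equidistributed n (\<alpha> \<circ> ?u \<circ> ?v) (\<sigma> \<circ> ?u \<circ> ?v) (\<alpha> \<circ> ?u \<circ> ?v \<circ> ?u) (\<sigma> \<circ> ?u \<circ> ?v \<circ> ?u)"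
      using equidistributed_adjacent[OF c2] Suc.prems by auto
    finally (equidistributed_trans) show ?thesis unfolding eq comp_assoc .
  qed
qed

lemma equidistributed_permute:
  assumes "\<pi> permutes {1..n}" "compatible n \<alpha> \<sigma>"
  shows "equidistributed n \<alpha> \<sigma> (\<alpha> \<circ> \<pi>) (\<sigma> \<circ> \<pi>)"
proof -
  \<comment> \<open>Shape and labels are quantified because the induction hypothesis is applied
    after a transposition has been composed with both.\<close>
  have "\<forall>\<alpha> \<sigma>. compatible n \<alpha> \<sigma> \<longrightarrow> equidistributed n \<alpha> \<sigma> (\<alpha> \<circ> \<pi>) (\<sigma> \<circ> \<pi>)"
    using assms(1) finite_atLeastAtMost
  proof (induction rule: permutes_induct)
    case id
    show ?case using equidistributed_basement by simp
  next
    case (swap a b p)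
    show ?case
    proof (intro allI impI)
      fix \<alpha> \<sigma> assume c: "compatible n \<alpha> \<sigma>"
      let ?t = "Transposition.transpose a b"
      have "compatible n (\<alpha> \<circ> ?t) (\<sigma> \<circ> ?t)"
        by (rule compatible_permute[OF c permutes_swap_id]) (use swap in auto)
      then have "equidistributed n (\<alpha> \<circ> ?t) (\<sigma> \<circ> ?t) (\<alpha> \<circ> ?t \<circ> p) (\<sigma> \<circ> ?t \<circ> p)"
        using swap by blast
      moreover have "equidistributed n \<alpha> \<sigma> (\<alpha> \<circ> ?t) (\<sigma> \<circ> ?t)"
        using equidistributed_transpose[OF c, of a b] equidistributed_transpose[OF c, of b a] swap
        by (cases a b rule: linorder_cases) (auto simp: transpose_commute)
      ultimately show "equidistributed n \<alpha> \<sigma> (\<alpha> \<circ> (?t \<circ> p)) (\<sigma> \<circ> (?t \<circ> p))"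
        unfolding comp_assoc using equidistributed_trans by blast
    qed
  qed
  then show ?thesis using assms(2) by blast
qed

theorem theorem5p7:
  fixes n :: nat and lam \<tau> :: "nat \<Rightarrow> nat"
  assumes "is_partition n lam"
    and "\<tau> permutes {1..n}"
  shows "(\<exists>\<Phi>. bij_betw \<Phi> (InvFree n (perm_seq \<tau> lam) (perm_seq \<tau> (w0 n))) (InvFree n lam (w0 n)) \<and>
            (\<forall>F \<in> InvFree n (perm_seq \<tau> lam) (perm_seq \<tau> (w0 n)).
               (\<forall>j\<ge>1. column_set n lam (\<Phi> F) j = column_set n (perm_seq \<tau> lam) F j) \<and>
               maj n lam (\<Phi> F) = maj n (perm_seq \<tau> lam) F)) \<and>
         Htilde n (perm_seq \<tau> (w0 n)) (perm_seq \<tau> lam) = Htilde_part n lam"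
proof -
  \<comment> \<open>In a partition a strictly longer row stands higher, and \<open>w0\<close>
    decreases down the rows.\<close>
  have "compatible n lam (w0 n)"
    unfolding compatible_def
  proof (intro ballI impI)
    fix r k assume "r \<in> {1..n}" "k \<in> {1..n}" "lam r < lam k"
    moreover from this have "k < r"
      using assms(1) unfolding is_partition_def by (metis atLeastAtMost_iff leD leI)
    ultimately show "w0 n r < w0 n k" by (auto simp: w0_def)
  qed
  \<comment> \<open>Acting by \<tau> on positions is composition with \<open>inv \<tau>\<close>, so
    the result for permuted rows is used with the inverse permutation.\<close>
  then have "equidistributed n lam (w0 n) (perm_seq \<tau> lam) (perm_seq \<tau> (w0 n))"
    using equidistributed_permute[OF permutes_inv[OF assms(2)]] by (simp add: perm_seq_def comp_def)
  then have e: "equidistributed n (perm_seq \<tau> lam) (perm_seq \<tau> (w0 n)) lam (w0 n)"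
    by (rule equidistributed_sym)
  then show ?thesis
    using equidistributed_Htilde[OF e] unfolding equidistributed_def Htilde_part_def by simp
qed

end
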